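(* Let $\Delta$ be an infinite irreducible locally finite thick building and let $\Gamma\leq\mathrm{Aut}(\Delta)$ act cocompactly on $\Delta$. Let $H_n\to H$ be a converging sequence in $\mathbf{Sub}(\mathrm{Aut}(\Delta))$ whose limit $H$ is Weyl-transitive. Suppose that for each $n\geq 1$ there exists $\tau_n\in\mathrm{Aut}(\Delta)$ such that $\tau_n\Gamma\tau_n^{-1}\leq H_n$. Then $$[H:\mathrm{Mon}(H)]\leq\limsup_{n\to\infty}\,[H_n:H_n^{(\infty)}].$$ In particular, if $H_n$ has no proper open subgroup of finite index for each $n\geq 1$, then $H$ is topologically simple.
   Context: $\Delta$ is viewed as a set of chambers $\mathrm{Ch}(\Delta)$ with Weyl distance $\delta\colon\mathrm{Ch}(\Delta)\times\mathrm{Ch}(\Delta)\to W$, where $(W,S)$ is the Coxeter system of its type (finite rank); irreducible refers to $(W,S)$. Locally finite means that the graph with vertex set $\mathrm{Ch}(\Delta)$ and edges the pairs of adjacent chambers is locally finite; thick means every panel is contained in at least $3$ chambers. $\mathrm{Aut}(\Delta)$ is the group of (type-preserving, i.e. Weyl-distance-preserving) automorphisms, with the topology of pointwise convergence on chambers; it is totally disconnected locally compact. A group acts cocompactly on $\Delta$ if it has finitely many orbits of chambers. $H\leq\mathrm{Aut}(\Delta)$ is Weyl-transitive if for each $w\in W$ it is transitive on the ordered pairs $(c_1,c_2)$ of chambers with $\delta(c_1,c_2)=w$. $\mathbf{Sub}(\mathrm{Aut}(\Delta))$ is the space of closed subgroups with the Chabauty topology. For a topological group $H$, $\mathrm{Mon}(H)$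 is the (possibly trivial) intersection of all non-trivial closed normal subgroups of $H$, and $H^{(\infty)}$ is the intersection of all open subgroups of finite index of $H$. $H$ is topologically simple if it is non-trivial and its only closed normal subgroups are the trivial group and $H$. Indices take values in $\{1,2,\dots\}\cup\{\infty\}$. *)

theory Defs
  imports "HOL-Analysis.Analysis" "HOL-Algebra.Algebra"
begin

section \<open>Coxeter systems\<close>

text \<open>
  Equality of words over S in the group with presentation
  \<open>\<langle>S | (s t)^m(s,t) = 1\<rangle>\<close>, where \<open>m(s,t)\<close> is the order of \<open>s t\<close> in W.
  The case \<open>s = t\<close> gives \<open>s s = 1\<close>, so no formal inverses are needed. The library
  sets \<open>ord x = 0\<close> for x of infinite order, which yields no relation.
\<close>

inductive coxeter_eq :: "('w, 'b) monoid_scheme \<Rightarrow> 'w set \<Rightarrow> 'w list \<Rightarrow> 'w list \<Rightarrow> bool"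
  for W S where
  rel: "\<lbrakk>s \<in> S; t \<in> S; set us \<subseteq> S; set vs \<subseteq> S\<rbrakk> \<Longrightarrow>
    coxeter_eq W S (us @ concat (replicate (group.ord W (s \<otimes>\<^bsub>W\<^esub> t)) [s, t]) @ vs) (us @ vs)"
| refl: "set us \<subseteq> S \<Longrightarrow> coxeter_eq W S us us"
| sym: "coxeter_eq W S us vs \<Longrightarrow> coxeter_eq W S vs us"
| trans: "coxeter_eq W S us vs \<Longrightarrow> coxeter_eq W S vs ws \<Longrightarrow> coxeter_eq W S us ws"

definition word_value :: "('w, 'b) monoid_scheme \<Rightarrow> 'w list \<Rightarrow> 'w" where
  "word_value W us = foldr (\<otimes>\<^bsub>W\<^esub>) us \<one>\<^bsub>W\<^esub>"

locale coxeter_system = group W for W :: "('w, 'b) monoid_scheme" (structure) +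
  fixes S :: "'w set"
  assumes S_carrier: "S \<subseteq> carrier W"
    and S_generates: "generate W S = carrier W"
    and S_order_two: "s \<in> S \<Longrightarrow> ord s = 2"
    and presentation:
      "\<lbrakk>set us \<subseteq> S; set vs \<subseteq> S; word_value W us = word_value W vs\<rbrakk> \<Longrightarrow> coxeter_eq W S us vs"

definition coxeter_length :: "('w, 'b) monoid_scheme \<Rightarrow> 'w set \<Rightarrow> 'w \<Rightarrow> nat" where
  "coxeter_length W S w = (LEAST n. \<exists>us. set us \<subseteq> S \<and> length us = n \<and> word_value W us = w)"

text \<open>The Coxeter diagram (an edge whenever s and t do not commute) is nonempty and connected.\<close>

definition coxeter_irreducible :: "('w, 'b) monoid_scheme \<Rightarrow> 'w set \<Rightarrow> bool" where
  "coxeter_irreducible W S \<longleftrightarrow> S \<noteq> {} \<and>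
     (\<forall>I. I \<subseteq> S \<and> I \<noteq> {} \<and> I \<noteq> S \<longrightarrow>
        (\<exists>s\<in>I. \<exists>t\<in>S - I. s \<otimes>\<^bsub>W\<^esub> t \<noteq> t \<otimes>\<^bsub>W\<^esub> s))"


section \<open>Buildings as sets of chambers with a Weyl distance\<close>

locale building = coxeter_system W S
  for W :: "('w, 'b) monoid_scheme" (structure) and S :: "'w set" +
  fixes Ch :: "'c set" and \<delta> :: "'c \<Rightarrow> 'c \<Rightarrow> 'w"
  assumes Ch_nonempty: "Ch \<noteq> {}"
    and dist_closed: "\<lbrakk>c \<in> Ch; d \<in> Ch\<rbrakk> \<Longrightarrow> \<delta> c d \<in> carrier W"
    and WD1: "\<lbrakk>c \<in> Ch; d \<in> Ch\<rbrakk> \<Longrightarrow> \<delta> c d = \<one> \<longleftrightarrow> c = d"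
    and WD2: "\<lbrakk>c \<in> Ch; d \<in> Ch; c' \<in> Ch; s \<in> S; \<delta> c' c = s\<rbrakk> \<Longrightarrow>
      \<delta> c' d = s \<otimes> \<delta> c d \<or> \<delta> c' d = \<delta> c d"
    and WD2_longer: "\<lbrakk>c \<in> Ch; d \<in> Ch; c' \<in> Ch; s \<in> S; \<delta> c' c = s;
      coxeter_length W S (s \<otimes> \<delta> c d) = coxeter_length W S (\<delta> c d) + 1\<rbrakk> \<Longrightarrow>
      \<delta> c' d = s \<otimes> \<delta> c d"
    and WD3: "\<lbrakk>c \<in> Ch; d \<in> Ch; s \<in> S\<rbrakk> \<Longrightarrow> \<exists>c'\<in>Ch. \<delta> c' c = s \<and> \<delta> c' d = s \<otimes> \<delta> c d"

definition locally_finite_building :: "'w set \<Rightarrow> 'c set \<Rightarrow> ('c \<Rightarrow> 'c \<Rightarrow> 'w) \<Rightarrow> bool" where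
  "locally_finite_building S Ch \<delta> \<longleftrightarrow> (\<forall>c\<in>Ch. finite {d \<in> Ch. \<delta> c d \<in> S})"

definition panel ::
    "('w, 'b) monoid_scheme \<Rightarrow> 'c set \<Rightarrow> ('c \<Rightarrow> 'c \<Rightarrow> 'w) \<Rightarrow> 'w \<Rightarrow> 'c \<Rightarrow> 'c set" where
  "panel W Ch \<delta> s c = {d \<in> Ch. \<delta> c d \<in> {\<one>\<^bsub>W\<^esub>, s}}"

definition thick_building ::
    "('w, 'b) monoid_scheme \<Rightarrow> 'w set \<Rightarrow> 'c set \<Rightarrow> ('c \<Rightarrow> 'c \<Rightarrow> 'w) \<Rightarrow> bool" where
  "thick_building W S Ch \<delta> \<longleftrightarrow> (\<forall>c\<in>Ch. \<forall>s\<in>S. \<exists>T \<subseteq> panel W Ch \<delta> s c. card T = 3)"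

definition aut_group :: "'c set \<Rightarrow> ('c \<Rightarrow> 'c \<Rightarrow> 'w) \<Rightarrow> ('c \<Rightarrow> 'c) monoid" where
  "aut_group Ch \<delta> = (BijGroup Ch)\<lparr>carrier :=
     {g \<in> Bij Ch. \<forall>c\<in>Ch. \<forall>d\<in>Ch. \<delta> (g c) (g d) = \<delta> c d}\<rparr>"

definition aut_topology :: "'c set \<Rightarrow> ('c \<Rightarrow> 'c \<Rightarrow> 'w) \<Rightarrow> ('c \<Rightarrow> 'c) topology" where
  "aut_topology Ch \<delta> =
     subtopology (product_topology (\<lambda>_. discrete_topology Ch) Ch) (carrier (aut_group Ch \<delta>))"

definition acts_cocompactly :: "'c set \<Rightarrow> ('c \<Rightarrow> 'c) set \<Rightarrow> bool" where
  "acts_cocompactly Ch \<Gamma> \<longleftrightarrow> finite ((\<lambda>c. {g c | g. g \<in> \<Gamma>}) ` Ch)"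

definition weyl_transitive ::
    "('w, 'b) monoid_scheme \<Rightarrow> 'c set \<Rightarrow> ('c \<Rightarrow> 'c \<Rightarrow> 'w) \<Rightarrow> ('c \<Rightarrow> 'c) set \<Rightarrow> bool" where
  "weyl_transitive W Ch \<delta> H \<longleftrightarrow>
     (\<forall>w\<in>carrier W. \<forall>c1\<in>Ch. \<forall>c2\<in>Ch. \<forall>d1\<in>Ch. \<forall>d2\<in>Ch.
        \<delta> c1 c2 = w \<and> \<delta> d1 d2 = w \<longrightarrow> (\<exists>h\<in>H. h c1 = d1 \<and> h c2 = d2))"


section \<open>Topological groups\<close>

text \<open>
  A topological group is given by a group G and a topology T on its carrier; a subgroup H of it
  is the pair of \<open>G\<lparr>carrier := H\<rparr>\<close> and \<open>subtopology T H\<close>.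
\<close>

definition closed_subgroups :: "('a, 'b) monoid_scheme \<Rightarrow> 'a topology \<Rightarrow> 'a set set" where
  "closed_subgroups G T = {H. subgroup H G \<and> closedin T H}"

definition chabauty_topology :: "('a, 'b) monoid_scheme \<Rightarrow> 'a topology \<Rightarrow> 'a set topology" where
  "chabauty_topology G T = topology_generated_by
     ({{H \<in> closed_subgroups G T. H \<inter> K = {}} | K. compactin T K} \<union>
      {{H \<in> closed_subgroups G T. H \<inter> U \<noteq> {}} | U. openin T U})"

definition group_index :: "('a, 'b) monoid_scheme \<Rightarrow> 'a set \<Rightarrow> enat" where
  "group_index G H = (if finite (rcosets\<^bsub>G\<^esub> H) then enat (card (rcosets\<^bsub>G\<^esub> H)) else \<infinity>)"

text \<open>Intersections are taken inside the group, so the empty intersection is the group itself.\<close>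

definition Mon :: "('a, 'b) monoid_scheme \<Rightarrow> 'a topology \<Rightarrow> 'a set" where
  "Mon G T = carrier G \<inter> \<Inter>{N. N \<lhd> G \<and> closedin T N \<and> N \<noteq> {\<one>\<^bsub>G\<^esub>}}"

definition finite_residual :: "('a, 'b) monoid_scheme \<Rightarrow> 'a topology \<Rightarrow> 'a set" where
  "finite_residual G T =
     carrier G \<inter> \<Inter>{K. subgroup K G \<and> openin T K \<and> group_index G K < \<infinity>}"

definition topologically_simple :: "('a, 'b) monoid_scheme \<Rightarrow> 'a topology \<Rightarrow> bool" where
  "topologically_simple G T \<longleftrightarrow> carrier G \<noteq> {\<one>\<^bsub>G\<^esub>} \<and>
     (\<forall>N. N \<lhd> G \<and> closedin T N \<longrightarrow> N = {\<one>\<^bsub>G\<^esub>} \<or> N = carrier G)"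

end

theory Submission
  imports Defs
begin

text \<open>
  Let N be a nontrivial normal subgroup of H. Thickness and irreducibility force N to be transitive on
  chambers, so that every point of H outside \<open>Mon\<close> is avoided by an open normal subgroup of
  finite index: enlarge N by the elements that agree with an element of N on a large disc. It therefore
  suffices to transfer a finite quotient H/N with N open to \<open>H\<^sub>n\<close> for infinitely many n.

  Since H is chamber-transitive, so is \<open>H\<^sub>n\<close> for large n, and hence \<open>\<tau>\<^sub>n\<close> may be assumed to
  fix a chamber b. By compactness these \<open>\<tau>\<^sub>n\<close> have a cluster point \<open>\<tau>\<close>, and \<open>\<tau> \<Gamma> \<tau>\<inverse> \<subseteq> H\<close>
  because H is closed. With \<open>\<theta> = \<tau> \<tau>\<^sub>n\<inverse>\<close>, which is close to the identity for infinitely many n, the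
  conjugate of \<open>H\<^sub>n\<close> by \<open>\<theta>\<close> contains \<open>\<tau> \<Gamma> \<tau>\<inverse>\<close> too. Being close to H near b and sharing with it a
  cocompact subgroup, this conjugate is close to H near every chamber. Sending an element to the coset of
  any element of H that agrees with it on some disc is then a well-defined homomorphism onto H/N.
\<close>

section \<open>Coxeter length and the Weyl distance\<close>

text \<open>The obstacle is uniformity. Chabauty convergence compares \<open>Hs n\<close> with H
  only on compact sets, that is, for automorphisms of bounded displacement at \<open>b\<close> and
  on a fixed disc, whereas a homomorphism on all of \<open>Hs n\<close> needs every element to be
  approximated, consistently with products. A cocompact group common to both sides turns the bounded
  comparison into one at every chamber. The conjugates of \<Gamma> inside \<open>Hs n\<close> vary
  with n and need not lie in H, which is why a correction by \<theta> is made.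

  If N contains the fixator of a disc of radius R, approximations are taken on discs of radius R +
  1: such a disc contains the R-discs about its centre and about each neighbour of the centre, so a
  coset of N can be carried along the connected chamber graph.

  Indices may be infinite, so they are compared through finite sets P of elements in distinct
  cosets: the finitely many quotients of elements of P are kept out of one N, and P is lifted to
  \<open>Hs n\<close>. A cluster point gives the bound for infinitely many n, which is what a limsup
  asks for.\<close>

context coxeter_system begin

lemma generator_closed: "s \<in> S \<Longrightarrow> s \<in> carrier W"
  using S_carrier by blast

lemma generator_square: "s \<in> S \<Longrightarrow> s \<otimes> s = \<one>"
  using S_order_two[of s] pow_ord_eq_1[of s] generator_closed[of s]
  by (simp add: numeral_2_eq_2)

lemma generator_inv: "s \<in> S \<Longrightarrow> inv s = s"
  by (simp add: generator_closed generator_square inv_equality)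

lemma generator_cancel_left:
  "\<lbrakk>s \<in> S; w \<in> carrier W\<rbrakk> \<Longrightarrow> s \<otimes> (s \<otimes> w) = w"
  by (metis generator_closed generator_square l_one m_assoc)

lemma generator_cancel_right:
  "\<lbrakk>s \<in> S; w \<in> carrier W\<rbrakk> \<Longrightarrow> (w \<otimes> s) \<otimes> s = w"
  by (metis generator_closed generator_square r_one m_assoc)

lemma generator_neq_one: "s \<in> S \<Longrightarrow> s \<noteq> \<one>"
  using S_order_two[of s] by auto

lemma word_value_Nil [simp]: "word_value W [] = \<one>"
  and word_value_Cons [simp]: "word_value W (s # us) = s \<otimes> word_value W us"
  by (simp_all add: word_value_def)

lemma word_value_closed: "set us \<subseteq> S \<Longrightarrow> word_value W us \<in> carrier W"
  by (induction us) (auto simp: generator_closed)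

lemma word_value_append:
  "\<lbrakk>set us \<subseteq> S; set vs \<subseteq> S\<rbrakk> \<Longrightarrow> word_value W (us @ vs) = word_value W us \<otimes> word_value W vs"
  by (induction us) (auto simp: generator_closed word_value_closed m_assoc)

lemma word_value_rev: "set us \<subseteq> S \<Longrightarrow> word_value W (rev us) = inv (word_value W us)"
  by (induction us)
    (auto simp: generator_closed word_value_closed word_value_append inv_mult_group generator_inv)

lemma word_exists:
  assumes "w \<in> carrier W"
  shows "\<exists>us. set us \<subseteq> S \<and> word_value W us = w"
proof -
  have "w \<in> generate W S"
    using assms S_generates by simp
  then show ?thesis
  proof induction
    case one
    show ?case by (rule exI[of _ "[]"]) simp
  next
    case (incl s)
    then show ?case by (intro exI[of _ "[s]"]) (simp add: generator_closed)
  next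
    case (inv s)
    then show ?case by (intro exI[of _ "[s]"]) (simp add: generator_closed generator_inv)
  next
    case (eng v w)
    then obtain us vs where "set us \<subseteq> S" "word_value W us = v" "set vs \<subseteq> S" "word_value W vs = w"
      by blast
    then show ?case by (intro exI[of _ "us @ vs"]) (simp add: word_value_append)
  qed
qed

lemma reduced_word_exists:
  assumes "w \<in> carrier W"
  shows "\<exists>us. set us \<subseteq> S \<and> length us = coxeter_length W S w \<and> word_value W us = w"
  unfolding coxeter_length_def
  by (rule LeastI_ex) (use word_exists[OF assms] in blast)

lemma length_word_value_le:
  "set us \<subseteq> S \<Longrightarrow> coxeter_length W S (word_value W us) \<le> length us"
  unfolding coxeter_length_def by (rule Least_le) blast

lemma length_generator_mult_le:
  assumes "s \<in> S" "w \<in> carrier W"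
  shows "coxeter_length W S (s \<otimes> w) \<le> coxeter_length W S w + 1"
proof -
  obtain us where "set us \<subseteq> S" "length us = coxeter_length W S w" "word_value W us = w"
    using reduced_word_exists[OF assms(2)] by blast
  then show ?thesis
    using length_word_value_le[of "s # us"] assms by simp
qed

lemma length_inv_le:
  assumes "w \<in> carrier W"
  shows "coxeter_length W S (inv w) \<le> coxeter_length W S w"
proof -
  obtain us where "set us \<subseteq> S" "length us = coxeter_length W S w" "word_value W us = w"
    using reduced_word_exists[OF assms] by blast
  then show ?thesis
    using length_word_value_le[of "rev us"] by (simp add: word_value_rev)
qed

lemma length_inv: "w \<in> carrier W \<Longrightarrow> coxeter_length W S (inv w) = coxeter_length W S w"
  using length_inv_le[of w] length_inv_le[of "inv w"] by simp

text \<open>Each defining relator is a power of a two-letter word and so has even length, whatever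
  \<open>ord\<close> returns, including its default 0. The parity of a word thus depends only on the
  element it represents; it stands in for the sign character of W.\<close>

lemma coxeter_eq_parity: "coxeter_eq W S us vs \<Longrightarrow> even (length us) = even (length vs)"
proof (induction rule: coxeter_eq.induct)
  case (rel s t us vs)
  have "length (concat (replicate k [s, t])) = 2 * k" for k
    by (induction k) auto
  then show ?case by simp
qed auto

lemma length_parity:
  assumes "set us \<subseteq> S"
  shows "even (coxeter_length W S (word_value W us)) = even (length us)"
  using reduced_word_exists[OF word_value_closed[OF assms]] presentation[OF _ assms]
    coxeter_eq_parity by metis

lemma length_eq_0_iff:
  assumes "w \<in> carrier W"
  shows "coxeter_length W S w = 0 \<longleftrightarrow> w = \<one>"
  using reduced_word_exists[OF assms] length_word_value_le[of "[]"] by fastforce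

lemma length_generator: "s \<in> S \<Longrightarrow> coxeter_length W S s = 1"
  using length_word_value_le[of "[s]"] length_eq_0_iff[of s] generator_neq_one[of s]
  by (simp add: generator_closed)

text \<open>The length is at most 2, even by parity, and nonzero because
  \<open>s \<otimes> t = \<one>\<close> would give \<open>t = inv s = s\<close>.\<close>

lemma length_two_generators:
  assumes "s \<in> S" "t \<in> S" "s \<noteq> t"
  shows "coxeter_length W S (s \<otimes> t) = 2"
proof -
  have "s \<otimes> t \<noteq> \<one>"
    using assms generator_inv[of s] inv_equality[of s t] inv_inv generator_closed
    by (metis inv_solve_left' r_one one_closed)
  then have "coxeter_length W S (s \<otimes> t) \<noteq> 0"
    using assms by (simp add: length_eq_0_iff generator_closed)
  moreover have "coxeter_length W S (s \<otimes> t) \<le> 2" "even (coxeter_length W S (s \<otimes> t))"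
    using length_word_value_le[of "[s, t]"] length_parity[of "[s, t]"] assms
    by (simp_all add: generator_closed)
  ultimately show ?thesis
    by (cases "coxeter_length W S (s \<otimes> t) = 1") auto
qed

end

section \<open>Galleries and the right-handed forms of the axioms for the Weyl distance\<close>

context building begin

text \<open>WD2 applied to the path from c to d and back leaves two values for
  \<open>\<delta> c c = \<one>\<close>; the one saying \<open>\<delta> d c = \<one>\<close> would
  force c = d.\<close>

lemma dist_generator_sym:
  assumes "c \<in> Ch" "d \<in> Ch" "\<delta> c d \<in> S"
  shows "\<delta> d c = \<delta> c d"
proof -
  have "\<delta> c c = \<delta> c d \<otimes> \<delta> d c \<or> \<delta> c c = \<delta> d c"
    using WD2[of d c c] assms by simp
  moreover have "\<delta> d c \<noteq> \<one>"
    using assms WD1[of c d] WD1[of d c] generator_neq_one by metis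
  ultimately have "\<delta> c d \<otimes> \<delta> d c = \<one>"
    using assms WD1[of c c] by metis
  then show ?thesis
    using assms dist_closed generator_inv by (metis inv_comm inv_equality)
qed

text \<open>The word is the type of the gallery. A step has distance exactly s, never
  \<open>\<one>\<close>, so galleries whose type is a word over S do not stammer.\<close>

primrec gallery :: "'w list \<Rightarrow> 'c \<Rightarrow> 'c \<Rightarrow> bool" where
  "gallery [] c d \<longleftrightarrow> c = d"
| "gallery (s # us) c d \<longleftrightarrow> (\<exists>e\<in>Ch. \<delta> c e = s \<and> gallery us e d)"

lemma gallery_snoc:
  "\<lbrakk>gallery us c d; d \<in> Ch; e \<in> Ch; \<delta> d e = s\<rbrakk> \<Longrightarrow> gallery (us @ [s]) c e"
  by (induction us arbitrary: c) auto

lemma gallery_rev: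
  assumes "set us \<subseteq> S" "gallery us c d" "c \<in> Ch" "d \<in> Ch"
  shows "gallery (rev us) d c"
  using assms
proof (induction us arbitrary: c)
  case (Cons s us)
  then obtain e where "e \<in> Ch" "\<delta> c e = s" "gallery us e d"
    by auto
  with Cons show ?case
    using gallery_snoc[of "rev us" d e c s] dist_generator_sym[of c e] by auto
qed simp

text \<open>WD3 realises the first letter and cancels it from the distance. This works for every
  word, whereas the converse below concerns reduced ones.\<close>

lemma gallery_exists:
  assumes "set us \<subseteq> S" "c \<in> Ch" "d \<in> Ch" "\<delta> c d = word_value W us"
  shows "gallery us c d"
  using assms
proof (induction us arbitrary: c)
  case Nil
  then show ?case using WD1 by auto
next
  case (Cons s us)
  obtain e where e: "e \<in> Ch" "\<delta> e c = s" "\<delta> e d = s \<otimes> \<delta> c d"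
    using WD3[of c d s] Cons.prems by auto
  with Cons have "gallery us e d"
    using generator_cancel_left word_value_closed by auto
  with e Cons.prems show ?case
    using dist_generator_sym[of e c] by auto
qed

text \<open>Tails of a reduced word are reduced, so along the gallery, read from its end, each
  letter lengthens the distance and \<open>WD2_longer\<close> leaves no choice.\<close>

lemma dist_reduced_gallery:
  assumes "set us \<subseteq> S" "coxeter_length W S (word_value W us) = length us"
    "gallery us c d" "c \<in> Ch" "d \<in> Ch"
  shows "\<delta> c d = word_value W us"
  using assms
proof (induction us arbitrary: c)
  case Nil
  then show ?case using WD1 by auto
next
  case (Cons s us)
  then obtain e where e: "e \<in> Ch" "\<delta> c e = s" "gallery us e d"
    by auto
  have us: "coxeter_length W S (word_value W us) = length us"
    using Cons.prems length_generator_mult_le[of s "word_value W us"]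
      length_word_value_le[of us] word_value_closed[of us] by simp
  with Cons e have "\<delta> e d = word_value W us"
    by simp
  with us e Cons.prems show ?case
    using WD2_longer[of e d c s] by simp
qed

text \<open>A gallery of reduced type can be reversed, and the reversed type is again reduced
  because inversion preserves length. This yields the right-handed axioms below.\<close>

lemma dist_sym:
  assumes "c \<in> Ch" "d \<in> Ch"
  shows "\<delta> d c = inv (\<delta> c d)"
proof -
  obtain us where us: "set us \<subseteq> S" "length us = coxeter_length W S (\<delta> c d)"
      "word_value W us = \<delta> c d"
    using reduced_word_exists[OF dist_closed[OF assms]] by blast
  then have "gallery (rev us) d c"
    using gallery_rev gallery_exists assms by simp
  then show ?thesis
    using dist_reduced_gallery[of "rev us" d c] us assms
    by (simp add: word_value_rev length_inv dist_closed)
qed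

lemma WD2_right:
  assumes "c \<in> Ch" "d \<in> Ch" "d' \<in> Ch" "s \<in> S" "\<delta> d d' = s"
  shows "\<delta> c d' = \<delta> c d \<otimes> s \<or> \<delta> c d' = \<delta> c d"
proof -
  have "\<delta> d' c = s \<otimes> \<delta> d c \<or> \<delta> d' c = \<delta> d c"
    using WD2[of d c d' s] assms dist_generator_sym[of d d'] by simp
  then show ?thesis
    using assms dist_sym[of d' c] dist_sym[of d c]
    by (auto simp: inv_mult_group generator_closed dist_closed generator_inv)
qed

lemma WD2_longer_right:
  assumes "c \<in> Ch" "d \<in> Ch" "d' \<in> Ch" "s \<in> S" "\<delta> d d' = s"
    "coxeter_length W S (\<delta> c d \<otimes> s) = coxeter_length W S (\<delta> c d) + 1"
  shows "\<delta> c d' = \<delta> c d \<otimes> s"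
proof -
  have "s \<otimes> \<delta> d c = inv (\<delta> c d \<otimes> s)"
    using assms dist_sym[of c d] by (simp add: inv_mult_group generator_closed dist_closed generator_inv)
  then have "\<delta> d' c = s \<otimes> \<delta> d c"
    using WD2_longer[of d c d' s] assms dist_generator_sym[of d d'] dist_sym[of c d]
    by (simp add: length_inv generator_closed dist_closed)
  then show ?thesis
    using assms dist_sym[of d' c] dist_sym[of d c]
    by (simp add: inv_mult_group generator_closed dist_closed generator_inv)
qed

lemma WD3_right:
  assumes "c \<in> Ch" "d \<in> Ch" "s \<in> S"
  shows "\<exists>d'\<in>Ch. \<delta> d d' = s \<and> \<delta> c d' = \<delta> c d \<otimes> s"
proof -
  obtain d' where "d' \<in> Ch" "\<delta> d' d = s" "\<delta> d' c = s \<otimes> \<delta> d c"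
    using WD3[of d c s] assms by blast
  then show ?thesis
    using assms dist_sym[of d' c] dist_sym[of d c] dist_generator_sym[of d' d]
    by (intro bexI[of _ d'])
      (simp_all add: inv_mult_group generator_closed dist_closed generator_inv)
qed

text \<open>Connectedness of the chamber graph in the form of an induction rule: an orbit, or the
  set of chambers with some property, is shown to be everything by closing it under
  adjacency.\<close>

lemma adjacency_connected:
  assumes "Y \<subseteq> Ch" "Y \<noteq> {}"
    and step: "\<And>c d. \<lbrakk>c \<in> Y; d \<in> Ch; \<delta> c d \<in> S\<rbrakk> \<Longrightarrow> d \<in> Y"
  shows "Y = Ch"
proof -
  have reach: "d \<in> Y" if "set us \<subseteq> S" "gallery us c d" "c \<in> Y" for us c d
    using that step by (induction us arbitrary: c) auto
  obtain c where c: "c \<in> Y"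
    using assms by blast
  have "d \<in> Y" if d: "d \<in> Ch" for d
  proof -
    obtain us where "set us \<subseteq> S" "word_value W us = \<delta> c d"
      using word_exists[of "\<delta> c d"] dist_closed c d assms(1) by blast
    then show ?thesis
      using reach[of us c d] gallery_exists[of us c d] c d assms(1) by auto
  qed
  with assms(1) show ?thesis by blast
qed

text \<open>A panel with three chambers has one besides c and d; WD2 leaves
  \<open>s \<otimes> s = \<one>\<close> or s for its distance from d, and the former would make it
  equal to d.\<close>

lemma thick_third_chamber:
  assumes "thick_building W S Ch \<delta>" "c \<in> Ch" "d \<in> Ch" "s \<in> S" "\<delta> c d = s"
  shows "\<exists>e\<in>Ch. \<delta> c e = s \<and> \<delta> d e = s"
proof -
  obtain P where P: "P \<subseteq> panel W Ch \<delta> s c" "card P = 3"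
    using assms unfolding thick_building_def by blast
  have "\<not> P \<subseteq> {c, d}"
    using P(2) card_mono[of "{c, d}" P] card_insert_le_m1[of 2 "{d}" c] by auto
  then obtain e where "e \<in> P" "e \<noteq> c" "e \<noteq> d"
    by blast
  with P have e: "e \<in> Ch" "\<delta> c e = s"
    using WD1[of c e] assms by (auto simp: panel_def)
  have "\<delta> d e = s \<otimes> \<delta> c e \<or> \<delta> d e = \<delta> c e"
    using WD2[of c e d s] dist_generator_sym[of c d] assms e by simp
  moreover have "\<delta> d e \<noteq> \<one>"
    using WD1[of d e] e assms \<open>e \<noteq> d\<close> by auto
  ultimately show ?thesis
    using e assms generator_square by auto
qed

end

section \<open>Automorphisms and normal subgroups of Weyl-transitive groups\<close>

lemma aut_carrier_iff:
  "g \<in> carrier (aut_group Ch \<delta>) \<longleftrightarrow>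
    g \<in> extensional Ch \<and> bij_betw g Ch Ch \<and> (\<forall>c\<in>Ch. \<forall>d\<in>Ch. \<delta> (g c) (g d) = \<delta> c d)"
  by (auto simp: aut_group_def Bij_def)

lemma aut_closed: "\<lbrakk>g \<in> carrier (aut_group Ch \<delta>); c \<in> Ch\<rbrakk> \<Longrightarrow> g c \<in> Ch"
  by (auto simp: aut_carrier_iff bij_betw_def)

lemma aut_dist:
  "\<lbrakk>g \<in> carrier (aut_group Ch \<delta>); c \<in> Ch; d \<in> Ch\<rbrakk> \<Longrightarrow> \<delta> (g c) (g d) = \<delta> c d"
  by (simp add: aut_carrier_iff)

lemma aut_inj:
  "\<lbrakk>g \<in> carrier (aut_group Ch \<delta>); c \<in> Ch; d \<in> Ch\<rbrakk> \<Longrightarrow> g c = g d \<longleftrightarrow> c = d"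
  by (auto simp: aut_carrier_iff bij_betw_def inj_on_eq_iff)

lemma aut_mult_apply:
  "\<lbrakk>g \<in> carrier (aut_group Ch \<delta>); h \<in> carrier (aut_group Ch \<delta>); c \<in> Ch\<rbrakk> \<Longrightarrow>
    (g \<otimes>\<^bsub>aut_group Ch \<delta>\<^esub> h) c = g (h c)"
  by (simp add: aut_group_def BijGroup_def compose_def)

lemma aut_one_apply: "c \<in> Ch \<Longrightarrow> \<one>\<^bsub>aut_group Ch \<delta>\<^esub> c = c"
  by (simp add: aut_group_def BijGroup_def)

lemma aut_ext:
  "\<lbrakk>g \<in> carrier (aut_group Ch \<delta>); h \<in> carrier (aut_group Ch \<delta>); \<And>c. c \<in> Ch \<Longrightarrow> g c = h c\<rbrakk>
    \<Longrightarrow> g = h"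
  by (auto simp: aut_carrier_iff intro: extensionalityI)

lemma group_aut_group: "group (aut_group Ch \<delta>)"
proof -
  interpret B: group "BijGroup Ch"
    by (rule group_BijGroup)
  let ?C = "carrier (aut_group Ch \<delta>)"
  have "subgroup ?C (BijGroup Ch)"
  proof (rule B.subgroupI)
    show "?C \<subseteq> carrier (BijGroup Ch)"
      by (auto simp: aut_group_def BijGroup_def)
    have "(\<lambda>x\<in>Ch. x) \<in> ?C"
      by (auto simp: aut_group_def id_Bij)
    then show "?C \<noteq> {}" by blast
  next
    fix g assume g: "g \<in> ?C"
    then have gB: "g \<in> Bij Ch"
      by (simp add: aut_group_def)
    have "bij_betw g Ch Ch"
      using g by (simp add: aut_carrier_iff)
    then have inv: "inv_into Ch g c \<in> Ch" "g (inv_into Ch g c) = c" if "c \<in> Ch" for c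
      using that by (auto simp: bij_betw_def inv_into_into f_inv_into_f)
    have "\<delta> (inv_into Ch g c) (inv_into Ch g d) = \<delta> c d" if "c \<in> Ch" "d \<in> Ch" for c d
      using that inv aut_dist[OF g, of "inv_into Ch g c" "inv_into Ch g d"] by simp
    then show "inv\<^bsub>BijGroup Ch\<^esub> g \<in> ?C"
      using gB by (simp add: inv_BijGroup aut_group_def restrict_inv_into_Bij)
  next
    fix g h assume gh: "g \<in> ?C" "h \<in> ?C"
    then have B: "g \<in> Bij Ch" "h \<in> Bij Ch"
      by (simp_all add: aut_group_def)
    moreover have "\<delta> (compose Ch g h c) (compose Ch g h d) = \<delta> c d" if "c \<in> Ch" "d \<in> Ch" for c d
      using gh that by (simp add: compose_def aut_dist aut_closed)
    ultimately show "g \<otimes>\<^bsub>BijGroup Ch\<^esub> h \<in> ?C"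
      by (simp add: BijGroup_def aut_group_def compose_Bij)
  qed
  then have "group (BijGroup Ch\<lparr>carrier := ?C\<rparr>)"
    by (rule B.subgroup_imp_group)
  then show ?thesis
    by (simp add: aut_group_def)
qed

lemma aut_inv_apply:
  assumes "g \<in> carrier (aut_group Ch \<delta>)" "c \<in> Ch"
  shows "(inv\<^bsub>aut_group Ch \<delta>\<^esub> g) (g c) = c" "g ((inv\<^bsub>aut_group Ch \<delta>\<^esub> g) c) = c"
proof -
  interpret A: group "aut_group Ch \<delta>"
    by (rule group_aut_group)
  show "(inv\<^bsub>aut_group Ch \<delta>\<^esub> g) (g c) = c"
    using assms A.l_inv[of g] aut_mult_apply[of "inv\<^bsub>aut_group Ch \<delta>\<^esub> g" Ch \<delta> g c]
      aut_one_apply[of c Ch \<delta>] by simp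
  show "g ((inv\<^bsub>aut_group Ch \<delta>\<^esub> g) c) = c"
    using assms A.r_inv[of g] aut_mult_apply[of g Ch \<delta> "inv\<^bsub>aut_group Ch \<delta>\<^esub> g" c]
      aut_one_apply[of c Ch \<delta>] by simp
qed

context building begin

text \<open>Lying in one N-orbit is an equivalence relation on chambers that depends only on the
  Weyl distance, since N is normal and H is Weyl-transitive. It is therefore encoded by a set D of
  elements of W. Thickness makes D contain the first letters of reduced words of its elements, and
  generators inside D commute with those outside, so irreducibility forces all of S into D.\<close>

lemma weyl_transitive_normal_subgroup_transitive:
  fixes H N :: "('c \<Rightarrow> 'c) set"
  defines "A \<equiv> aut_group Ch \<delta>"
  assumes thick: "thick_building W S Ch \<delta>" and irreducible: "coxeter_irreducible W S"
    and H: "subgroup H A" "weyl_transitive W Ch \<delta> H"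
    and N: "N \<lhd> A\<lparr>carrier := H\<rparr>" "N \<noteq> {\<one>\<^bsub>A\<^esub>}"
    and "c \<in> Ch" "d \<in> Ch"
  shows "\<exists>n\<in>N. n c = d"
proof -
  interpret A: group A
    unfolding A_def by (rule group_aut_group)
  have HA: "H \<subseteq> carrier A"
    using H(1) by (rule subgroup.subset)
  have HG: "group (A\<lparr>carrier := H\<rparr>)"
    using H(1) by (rule A.subgroup_imp_group)
  have NH: "subgroup N (A\<lparr>carrier := H\<rparr>)"
    using N normal_imp_subgroup by blast
  then have subNH: "N \<subseteq> H"
    using subgroup.subset by fastforce
  have NA: "subgroup N A"
    using H(1) NH A.incl_subgroup by blast
  have in_A: "n \<in> N \<Longrightarrow> n \<in> carrier (aut_group Ch \<delta>)" "h \<in> H \<Longrightarrow> h \<in> carrier (aut_group Ch \<delta>)" for n h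
    using HA subNH unfolding A_def by auto
  define E where "E c d \<longleftrightarrow> c \<in> Ch \<and> d \<in> Ch \<and> (\<exists>n\<in>N. n c = d)" for c d
  have E_sym: "E d c" if cd: "E c d" for c d
  proof -
    obtain n where n: "n \<in> N" "n c = d" "c \<in> Ch" "d \<in> Ch"
      using cd unfolding E_def by blast
    moreover have "inv\<^bsub>A\<^esub> n \<in> N"
      using NA n by (simp add: subgroup.m_inv_closed)
    moreover have "(inv\<^bsub>A\<^esub> n) d = c"
      unfolding A_def using aut_inv_apply(1)[OF in_A(1)[OF n(1)] n(3)] n(2) by simp
    ultimately show ?thesis
      unfolding E_def by blast
  qed
  have E_trans: "E c e" if cd: "E c d" "E d e" for c d e
  proof -
    obtain n m where n: "n \<in> N" "n c = d" "m \<in> N" "m d = e" "c \<in> Ch" "d \<in> Ch" "e \<in> Ch"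
      using cd unfolding E_def by blast
    moreover have "m \<otimes>\<^bsub>A\<^esub> n \<in> N"
      using NA n by (simp add: subgroup.m_closed)
    moreover have "(m \<otimes>\<^bsub>A\<^esub> n) c = e"
      unfolding A_def using n in_A aut_mult_apply by metis
    ultimately show ?thesis
      unfolding E_def by blast
  qed
  have E_dist: "E c' d'" if cd: "E c d" "c' \<in> Ch" "d' \<in> Ch" "\<delta> c' d' = \<delta> c d" for c d c' d'
  proof -
    obtain n where n: "n \<in> N" "n c = d" "c \<in> Ch" "d \<in> Ch"
      using cd unfolding E_def by blast
    \<comment> \<open>An h carrying (c, d) to (c', d') conjugates n into an element of N that
      carries c' to d'.\<close>
    obtain h where h: "h \<in> H" "h c = c'" "h d = d'"
      using H(2) cd n dist_closed unfolding weyl_transitive_def by metis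
    have "h \<otimes>\<^bsub>A\<^esub> n \<otimes>\<^bsub>A\<^esub> inv\<^bsub>A\<^esub> h \<in> N"
      using group.normal_invE(2)[OF HG N(1)] h n H(1) A.m_inv_consistent[of H h] by simp
    moreover have "(h \<otimes>\<^bsub>A\<^esub> n \<otimes>\<^bsub>A\<^esub> inv\<^bsub>A\<^esub> h) c' = d'"
      using h n in_A cd A.inv_closed[of h] A.m_closed[of h n] aut_inv_apply(1)[of h Ch \<delta> c]
      unfolding A_def by (simp add: aut_mult_apply)
    ultimately show ?thesis
      using cd unfolding E_def by blast
  qed
  define D where "D = {\<delta> c d | c d. E c d}"
  have D_I: "\<delta> c d \<in> D" if "E c d" for c d
    using that unfolding D_def by blast
  have D_E: "E c d" if "\<delta> c d \<in> D" "c \<in> Ch" "d \<in> Ch" for c d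
    using that E_dist unfolding D_def by blast
  have D_Cons: "s \<in> D" "v \<in> D"
    if w: "w \<in> D" "w = s \<otimes> v" "s \<in> S" "v \<in> carrier W" "coxeter_length W S w = coxeter_length W S v + 1" for w s v
  proof -
    obtain c d where cd: "E c d" "\<delta> c d = w" "c \<in> Ch" "d \<in> Ch"
      using w(1) unfolding D_def E_def by blast
    obtain c' where c': "c' \<in> Ch" "\<delta> c' c = s" "\<delta> c' d = v"
      using WD3[of c d s] w cd generator_cancel_left by auto
    \<comment> \<open>The third chamber of the panel of c and c' is again at distance w from d.
      Hence c and c'' both lie in the N-orbit of d, and their distance s belongs to D.\<close>
    obtain c'' where c'': "c'' \<in> Ch" "\<delta> c' c'' = s" "\<delta> c c'' = s"
      using thick_third_chamber[OF thick, of c' c s] c' w cd by blast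
    have "\<delta> c'' d = w"
      using WD2_longer[of c' d c'' s] dist_generator_sym[of c' c''] c' c'' w cd by simp
    then have "E c'' d"
      using D_E w(1) c'' cd by blast
    then have "E c c''"
      using cd E_sym E_trans by blast
    then show s: "s \<in> D"
      using D_I[of c c''] c'' by simp
    then have "E c' c"
      using D_E[of c' c] c' cd by simp
    then show "v \<in> D"
      using E_trans[of c' c d] cd D_I[of c' d] c' by simp
  qed
  text \<open>The \<open>\<delta>\<close>-values on N-orbits cannot contain t, which rules out that \<open>t s t\<close> has length 3. If it
    has length 1, a third chamber of a t-panel gives \<open>t s = s t\<close>, so that no exchange
    condition is needed.\<close>
  have comm: "s \<otimes> t = t \<otimes> s" if s: "s \<in> S" "s \<in> D" and t: "t \<in> S" "t \<notin> D" for s t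
  proof -
    note closed = generator_closed[OF s(1)] generator_closed[OF t(1)]
    have ts: "coxeter_length W S (t \<otimes> s) = 2" and st: "coxeter_length W S (s \<otimes> t) = 2"
      using length_two_generators s t by metis+
    obtain c d where cd: "E c d" "\<delta> c d = s" "c \<in> Ch" "d \<in> Ch"
      using s(2) unfolding D_def E_def by blast
    obtain n where n: "n \<in> N" "n c = d"
      using cd unfolding E_def by blast
    obtain c' where c': "c' \<in> Ch" "\<delta> c' c = t"
      using WD3[of c d t] cd t by blast
    \<comment> \<open>Transporting c' by n gives a chamber of the same orbit, joined to c' by a
      gallery of type t, s, t. Its distance from c' is \<open>t \<otimes> s\<close> or
      \<open>t \<otimes> s \<otimes> t\<close>, and \<open>D_Cons\<close> excludes the
      former.\<close>
    define d' where "d' = n c'"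
    have d': "d' \<in> Ch" "\<delta> d d' = t" "E c' d'"
      using aut_closed[of n Ch \<delta> c'] aut_dist[of n Ch \<delta> c c'] in_A n c' cd dist_generator_sym[of c' c] t
      unfolding d'_def E_def by auto
    have c'd: "\<delta> c' d = t \<otimes> s"
      using WD2_longer[of c d c' t] c' cd t ts length_generator[of s] s by simp
    have "t \<otimes> s \<notin> D"
      using D_Cons(1)[of "t \<otimes> s" t s] closed s t ts length_generator[of s] by auto
    moreover have "\<delta> c' d' = t \<otimes> s \<otimes> t \<or> \<delta> c' d' = t \<otimes> s"
      using WD2_right[of c' d d' t] d' c' cd c'd t by simp
    ultimately have tst: "t \<otimes> s \<otimes> t \<in> D"
      using D_I d' by metis
    have "coxeter_length W S (t \<otimes> s \<otimes> t) \<noteq> 3"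
      using D_Cons(1)[OF tst, of t "s \<otimes> t"] closed t st m_assoc by auto
    moreover have "odd (coxeter_length W S (t \<otimes> s \<otimes> t))" "coxeter_length W S (t \<otimes> s \<otimes> t) \<le> 3"
      using length_parity[of "[t, s, t]"] length_word_value_le[of "[t, s, t]"] s t closed
      by (simp_all add: m_assoc)
    ultimately have len: "coxeter_length W S (t \<otimes> s \<otimes> t) = 1"
      by presburger
    obtain e where e: "e \<in> Ch" "\<delta> d e = t" "\<delta> c' e = t \<otimes> s \<otimes> t"
      using WD3_right[of c' d t] c' cd t c'd by auto
    obtain e' where e': "e' \<in> Ch" "\<delta> d e' = t" "\<delta> e e' = t"
      using thick_third_chamber[OF thick, of d e t] cd e t by blast
    \<comment> \<open>The distance from c' to e' is computed once through e and once through c. The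
      second way leaves \<open>t \<otimes> s \<otimes> t\<close> or \<open>s \<otimes> t\<close>,
      and the former has the wrong length.\<close>
    have "\<delta> c' e' = t \<otimes> s"
      using WD2_longer_right[of c' e e' t] c' e e' t ts len closed generator_cancel_right[of t "t \<otimes> s"] by simp
    moreover have "\<delta> c e' = s \<otimes> t"
      using WD2_longer_right[of c d e' t] cd e' t st length_generator[of s] s by simp
    then have "\<delta> c' e' = t \<otimes> s \<otimes> t \<or> \<delta> c' e' = s \<otimes> t"
      using WD2[of c e' c' t] cd e' c' t closed by (auto simp: m_assoc)
    ultimately show ?thesis
      using ts len by auto
  qed
  \<comment> \<open>A nontrivial element of N moves some chamber, and the first letter of a reduced
    word for this displacement lies in D.\<close>
  have "S \<inter> D \<noteq> {}"
  proof -
    have "\<exists>n\<in>N. n \<noteq> \<one>\<^bsub>A\<^esub>"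
      using N(2) subgroup.one_closed[OF NA] by blast
    then obtain n where n: "n \<in> N" "n \<noteq> \<one>\<^bsub>A\<^esub>"
      by blast
    then obtain c where c: "c \<in> Ch" "n c \<noteq> c"
      using aut_ext[of n Ch \<delta> "\<one>\<^bsub>A\<^esub>"] in_A A.one_closed aut_one_apply[of _ Ch \<delta>] unfolding A_def by metis
    then have nc: "n c \<in> Ch" "\<delta> c (n c) \<in> D"
      using D_I[of c "n c"] aut_closed in_A n unfolding E_def by fast+
    obtain us where us: "set us \<subseteq> S" "length us = coxeter_length W S (\<delta> c (n c))" "word_value W us = \<delta> c (n c)"
      using reduced_word_exists dist_closed nc c by blast
    show ?thesis
    proof (cases us)
      case Nil
      then show ?thesis using us c nc WD1[of c "n c"] by simp
    next
      case (Cons s vs)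
      then have "coxeter_length W S (word_value W vs) \<le> length vs"
        "coxeter_length W S (\<delta> c (n c)) \<le> coxeter_length W S (word_value W vs) + 1"
        using us length_word_value_le[of vs] length_generator_mult_le[of s "word_value W vs"] word_value_closed[of vs] by auto
      then have "s \<in> D"
        using D_Cons(1)[OF nc(2), of s "word_value W vs"] us Cons word_value_closed[of vs] by auto
      then show ?thesis using us Cons by auto
    qed
  qed
  then have "S \<inter> D = S"
    using irreducible comm unfolding coxeter_irreducible_def by blast
  then have SD: "S \<subseteq> D"
    by blast
  have "E c c"
    using \<open>c \<in> Ch\<close> subgroup.one_closed[OF NA] aut_one_apply[of c Ch \<delta>] unfolding E_def A_def by blast
  have "{d. E c d} = Ch"
  proof (rule adjacency_connected)
    show "{d. E c d} \<subseteq> Ch" "{d. E c d} \<noteq> {}"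
      using \<open>E c c\<close> by (auto simp: E_def)
  next
    fix d e assume "d \<in> {d. E c d}" "e \<in> Ch" "\<delta> d e \<in> S"
    then have "E c d" "E d e"
      using D_E[of d e] SD by (auto simp: E_def)
    then show "e \<in> {d. E c d}"
      using E_trans by simp
  qed
  then show ?thesis
    using \<open>d \<in> Ch\<close> unfolding E_def by blast
qed

end

section \<open>The permutation topology and indices\<close>

text \<open>Values are discrete, so a basic neighbourhood of f prescribes the values of f on a
  finite set. The general L lets one criterion serve the full product, the automorphism group and
  its subgroups.\<close>

lemma openin_pointwise_iff:
  fixes L :: "('c \<Rightarrow> 'd) set"
  assumes "L \<subseteq> Ch \<rightarrow>\<^sub>E Y"
  shows "openin (subtopology (product_topology (\<lambda>_. discrete_topology Y) Ch) L) U \<longleftrightarrow>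
    U \<subseteq> L \<and> (\<forall>f\<in>U. \<exists>F. finite F \<and> F \<subseteq> Ch \<and> (\<forall>g\<in>L. (\<forall>z\<in>F. g z = f z) \<longrightarrow> g \<in> U))"
    (is "openin (subtopology ?P L) U \<longleftrightarrow> ?R")
proof
  assume "openin (subtopology ?P L) U"
  then obtain V where V: "openin ?P V" "U = V \<inter> L"
    by (auto simp: openin_subtopology)
  have "\<exists>F. finite F \<and> F \<subseteq> Ch \<and> (\<forall>g\<in>L. (\<forall>z\<in>F. g z = f z) \<longrightarrow> g \<in> U)" if "f \<in> U" for f
  proof -
    obtain Q where Q: "finite {i \<in> Ch. Q i \<noteq> Y}" "f \<in> PiE Ch Q" "PiE Ch Q \<subseteq> V"
      using V \<open>f \<in> U\<close> by (auto simp: openin_product_topology_alt)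
    have "g \<in> U" if g: "g \<in> L" "\<forall>z\<in>{i \<in> Ch. Q i \<noteq> Y}. g z = f z" for g
    proof -
      have "g \<in> PiE Ch Q"
      proof (rule PiE_I)
        fix z assume "z \<in> Ch"
        then show "g z \<in> Q z"
          using g assms Q(2) by (cases "Q z = Y") (auto dest: PiE_mem)
      next
        fix z assume "z \<notin> Ch"
        then show "g z = undefined"
          using g(1) assms by (auto dest: PiE_arb)
      qed
      then show ?thesis
        using g(1) Q V by auto
    qed
    then show ?thesis
      using Q(1) by (intro exI[of _ "{i \<in> Ch. Q i \<noteq> Y}"]) auto
  qed
  then show ?R
    using V by auto
next
  assume R: ?R
  \<comment> \<open>The union of the cylinders around points of U, taken in the full product; its
    trace on L is U.\<close>
  define V where "V = {g \<in> Ch \<rightarrow>\<^sub>E Y. \<exists>f\<in>U. \<exists>F. finite F \<and> F \<subseteq> Ch \<and>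
    (\<forall>g\<in>L. (\<forall>z\<in>F. g z = f z) \<longrightarrow> g \<in> U) \<and> (\<forall>z\<in>F. g z = f z)}"
  have "\<exists>Q. finite {i \<in> Ch. Q i \<noteq> Y} \<and> (\<forall>i\<in>Ch. Q i \<subseteq> Y) \<and> g \<in> PiE Ch Q \<and> PiE Ch Q \<subseteq> V"
    if gV: "g \<in> V" for g
  proof -
    obtain f F where fF: "g \<in> Ch \<rightarrow>\<^sub>E Y" "f \<in> U" "finite F" "F \<subseteq> Ch"
      "\<forall>g\<in>L. (\<forall>z\<in>F. g z = f z) \<longrightarrow> g \<in> U" "\<forall>z\<in>F. g z = f z"
      using gV unfolding V_def by blast
    let ?Q = "\<lambda>i. if i \<in> F then {g i} else Y"
    have "finite {i \<in> Ch. ?Q i \<noteq> Y}"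
      by (rule finite_subset[OF _ fF(3)]) auto
    moreover have "\<forall>i\<in>Ch. ?Q i \<subseteq> Y" "g \<in> PiE Ch ?Q"
      using fF(1) by (auto simp: PiE_iff)
    moreover have "PiE Ch ?Q \<subseteq> V"
    proof
      fix k assume k: "k \<in> PiE Ch ?Q"
      have "k z \<in> Y" if "z \<in> Ch" for z
        using PiE_mem[OF k that] PiE_mem[OF fF(1) that] by (auto split: if_splits)
      moreover have "k z = f z" if "z \<in> F" for z
        using PiE_mem[OF k, of z] that fF by auto
      ultimately show "k \<in> V"
        using fF k unfolding V_def by (auto simp: PiE_iff)
    qed
    ultimately show ?thesis
      by (intro exI[of _ ?Q] conjI)
  qed
  then have "openin ?P V"
    by (simp add: openin_product_topology_alt)
  moreover have "U = V \<inter> L"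
  proof
    show "V \<inter> L \<subseteq> U"
    proof
      fix g assume "g \<in> V \<inter> L"
      then obtain f F where "\<forall>g\<in>L. (\<forall>z\<in>F. g z = f z) \<longrightarrow> g \<in> U" "\<forall>z\<in>F. g z = f z" "g \<in> L"
        unfolding V_def by blast
      then show "g \<in> U"
        by simp
    qed
    show "U \<subseteq> V \<inter> L"
    proof
      fix f assume f: "f \<in> U"
      then obtain F where "finite F" "F \<subseteq> Ch" "\<forall>g\<in>L. (\<forall>z\<in>F. g z = f z) \<longrightarrow> g \<in> U"
        using R by blast
      moreover have "f \<in> Ch \<rightarrow>\<^sub>E Y" "f \<in> L"
        using R f assms by blast+
      ultimately show "f \<in> V \<inter> L"
        using f unfolding V_def by blast
    qed
  qed
  ultimately show "openin (subtopology ?P L) U"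
    by (auto simp: openin_subtopology)
qed

lemma closedin_pointwiseD:
  fixes L :: "('c \<Rightarrow> 'd) set"
  assumes "L \<subseteq> Ch \<rightarrow>\<^sub>E Y"
    and Q: "closedin (subtopology (product_topology (\<lambda>_. discrete_topology Y) Ch) L) Q"
    and "f \<in> L" "\<And>F. \<lbrakk>finite F; F \<subseteq> Ch\<rbrakk> \<Longrightarrow> \<exists>g\<in>Q. \<forall>z\<in>F. g z = f z"
  shows "f \<in> Q"
proof (rule ccontr)
  assume "f \<notin> Q"
  have top: "topspace (subtopology (product_topology (\<lambda>_. discrete_topology Y) Ch) L) = L"
    using assms(1) by auto
  then have "Q \<subseteq> L" "openin (subtopology (product_topology (\<lambda>_. discrete_topology Y) Ch) L) (L - Q)"
    using Q by (auto simp: closedin_def)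
  with \<open>f \<notin> Q\<close> \<open>f \<in> L\<close> obtain F where "finite F" "F \<subseteq> Ch" "\<forall>g\<in>L. (\<forall>z\<in>F. g z = f z) \<longrightarrow> g \<in> L - Q"
    unfolding openin_pointwise_iff[OF assms(1)] by blast
  then show False
    using assms(4)[of F] \<open>Q \<subseteq> L\<close> by blast
qed

lemma aut_carrier_PiE: "carrier (aut_group Ch \<delta>) \<subseteq> Ch \<rightarrow>\<^sub>E Ch"
proof
  fix g assume "g \<in> carrier (aut_group Ch \<delta>)"
  then show "g \<in> Ch \<rightarrow>\<^sub>E Ch"
    using aut_carrier_iff[of g Ch \<delta>] aut_closed[of g Ch \<delta>] by (simp add: PiE_def)
qed

lemma topspace_aut_topology: "topspace (aut_topology Ch \<delta>) = carrier (aut_group Ch \<delta>)"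
  using aut_carrier_PiE[of Ch \<delta>] by (auto simp: aut_topology_def)

lemma subtopology_aut_topology:
  "L \<subseteq> carrier (aut_group Ch \<delta>) \<Longrightarrow>
    subtopology (aut_topology Ch \<delta>) L = subtopology (product_topology (\<lambda>_. discrete_topology Ch) Ch) L"
  by (simp add: aut_topology_def subtopology_subtopology Int_absorb1)

lemma openin_aut_subtopology_iff:
  assumes "L \<subseteq> carrier (aut_group Ch \<delta>)"
  shows "openin (subtopology (aut_topology Ch \<delta>) L) U \<longleftrightarrow>
    U \<subseteq> L \<and> (\<forall>f\<in>U. \<exists>F. finite F \<and> F \<subseteq> Ch \<and> (\<forall>g\<in>L. (\<forall>z\<in>F. g z = f z) \<longrightarrow> g \<in> U))"
  unfolding subtopology_aut_topology[OF assms]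
  by (rule openin_pointwise_iff) (use assms aut_carrier_PiE[of Ch \<delta>] in blast)

lemma openin_aut_topology_iff:
  "openin (aut_topology Ch \<delta>) U \<longleftrightarrow> U \<subseteq> carrier (aut_group Ch \<delta>) \<and>
    (\<forall>f\<in>U. \<exists>F. finite F \<and> F \<subseteq> Ch \<and> (\<forall>g\<in>carrier (aut_group Ch \<delta>). (\<forall>z\<in>F. g z = f z) \<longrightarrow> g \<in> U))"
  unfolding aut_topology_def by (rule openin_pointwise_iff[OF aut_carrier_PiE])

lemma closedin_aut_subtopologyD:
  assumes "L \<subseteq> carrier (aut_group Ch \<delta>)" "closedin (subtopology (aut_topology Ch \<delta>) L) Q"
    and "f \<in> L" "\<And>F. \<lbrakk>finite F; F \<subseteq> Ch\<rbrakk> \<Longrightarrow> \<exists>g\<in>Q. \<forall>z\<in>F. g z = f z"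
  shows "f \<in> Q"
  using assms aut_carrier_PiE[of Ch \<delta>] closedin_pointwiseD[of L Ch Ch Q f]
  by (auto simp: subtopology_aut_topology)

text \<open>K is a union of left cosets of the fixator of F in L, and these are the traces on L of
  cylinders over F.\<close>

lemma openin_aut_subgroup:
  assumes "subgroup L (aut_group Ch \<delta>)" "subgroup K (aut_group Ch \<delta>)" "K \<subseteq> L" "finite F" "F \<subseteq> Ch"
    and fix_F: "\<And>l. \<lbrakk>l \<in> L; \<And>z. z \<in> F \<Longrightarrow> l z = z\<rbrakk> \<Longrightarrow> l \<in> K"
  shows "openin (subtopology (aut_topology Ch \<delta>) L) K"
proof -
  interpret A: group "aut_group Ch \<delta>"
    by (rule group_aut_group)
  let ?A = "aut_group Ch \<delta>"
  have LA: "L \<subseteq> carrier ?A"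
    using assms(1) by (rule subgroup.subset)
  have "g \<in> K" if g: "g \<in> L" "\<forall>z\<in>F. g z = k z" and k: "k \<in> K" for g k
  proof -
    have kg: "k \<in> carrier ?A" "g \<in> carrier ?A" "k \<in> L"
      using k g LA assms(3) by auto
    have "inv\<^bsub>?A\<^esub> k \<otimes>\<^bsub>?A\<^esub> g \<in> K"
    proof (rule fix_F)
      show "inv\<^bsub>?A\<^esub> k \<otimes>\<^bsub>?A\<^esub> g \<in> L"
        using assms(1) kg g by (simp add: subgroup.m_closed subgroup.m_inv_closed)
      show "(inv\<^bsub>?A\<^esub> k \<otimes>\<^bsub>?A\<^esub> g) z = z" if "z \<in> F" for z
        using that g kg assms(5) aut_inv_apply(1)[of k Ch \<delta> z]
        by (simp add: aut_mult_apply subset_iff)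
    qed
    then have "k \<otimes>\<^bsub>?A\<^esub> (inv\<^bsub>?A\<^esub> k \<otimes>\<^bsub>?A\<^esub> g) \<in> K"
      using assms(2) k by (simp add: subgroup.m_closed)
    then show ?thesis
      using kg by (simp add: A.inv_solve_left A.m_assoc[symmetric])
  qed
  then show ?thesis
    using assms(3,4,5) unfolding openin_aut_subtopology_iff[OF LA] by blast
qed

section \<open>Indices bounded below by finite sets of inequivalent elements\<close>

lemma (in group) group_index_ge:
  assumes "subgroup K G" "P \<subseteq> carrier G" "finite P"
    and distinct: "\<And>x y. \<lbrakk>x \<in> P; y \<in> P; x \<noteq> y\<rbrakk> \<Longrightarrow> x \<otimes> inv y \<notin> K"
  shows "enat (card P) \<le> group_index G K"
proof (cases "finite (rcosets K)")
  case True
  have "inj_on (\<lambda>x. K #> x) P"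
  proof (rule inj_onI, rule ccontr)
    fix x y assume xy: "x \<in> P" "y \<in> P" "K #> x = K #> y" "x \<noteq> y"
    then have "x \<in> K #> y"
      using rcos_self[of x K] assms by auto
    then obtain k where "k \<in> K" "x = k \<otimes> y"
      by (auto simp: r_coset_def)
    moreover have "k \<in> carrier G" "y \<in> carrier G"
      using \<open>k \<in> K\<close> assms xy subgroup.subset by blast+
    ultimately have "x \<otimes> inv y = k"
      by (simp add: m_assoc)
    then show False
      using distinct xy \<open>k \<in> K\<close> by blast
  qed
  moreover have "(\<lambda>x. K #> x) ` P \<subseteq> rcosets K"
    using assms(2) by (auto simp: RCOSETS_def)
  ultimately show ?thesis
    using True card_inj_on_le[of "\<lambda>x. K #> x" P "rcosets K"] by (simp add: group_index_def)
qed (simp add: group_index_def)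

text \<open>P consists of one representative in each of j cosets. An infinite index supplies j
  cosets for every finite j, so finite and infinite indices obey the same criterion.\<close>

lemma (in group) group_index_geE:
  assumes "subgroup K G" "enat j \<le> group_index G K"
  obtains P where "P \<subseteq> carrier G" "finite P" "card P = j"
    "\<forall>x\<in>P. \<forall>y\<in>P. x \<noteq> y \<longrightarrow> x \<otimes> inv y \<notin> K"
proof -
  obtain C where C: "C \<subseteq> rcosets K" "finite C" "card C = j"
  proof (cases "finite (rcosets K)")
    case True
    then show ?thesis
      using assms(2) that obtain_subset_with_card_n[of j "rcosets K"] by (auto simp: group_index_def)
  next
    case False
    then show ?thesis
      using that infinite_arbitrarily_large by blast
  qed
  have "\<forall>Q\<in>C. \<exists>x. x \<in> carrier G \<and> Q = K #> x"
    using C(1) by (auto simp: RCOSETS_def)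
  then obtain r where r: "\<And>Q. Q \<in> C \<Longrightarrow> r Q \<in> carrier G \<and> Q = K #> r Q"
    by metis
  have inj: "inj_on r C"
    using r by (metis inj_onI)
  show ?thesis
  proof (rule that[of "r ` C"])
    show "r ` C \<subseteq> carrier G" "finite (r ` C)" "card (r ` C) = j"
      using r C inj by (auto simp: card_image)
  next
    have "x \<otimes> inv y \<notin> K" if xy: "x \<in> r ` C" "y \<in> r ` C" "x \<noteq> y" for x y
    proof -
      from xy obtain Q Y where XY: "x = r Q" "y = r Y" "Q \<in> C" "Y \<in> C" "Q \<noteq> Y"
        by blast
      show ?thesis
      proof
        assume "x \<otimes> inv y \<in> K"
        moreover have "x \<in> carrier G" "y \<in> carrier G"
          using XY r by auto
        then have "x = x \<otimes> inv y \<otimes> y"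
          by (simp add: m_assoc)
        ultimately have "x \<in> K #> y"
          by (auto simp: r_coset_def)
        then have "K #> y = K #> x"
          using assms(1) \<open>y \<in> carrier G\<close> repr_independence by blast
        then show False
          using XY r by metis
      qed
    qed
    then show "\<forall>x\<in>r ` C. \<forall>y\<in>r ` C. x \<noteq> y \<longrightarrow> x \<otimes> inv y \<notin> K"
      by blast
  qed
qed

lemma (in group_hom) finite_rcosets_kernel:
  assumes "finite (carrier H)"
  shows "finite (rcosets (kernel G H h))"
proof -
  have "(\<lambda>Q. the_elem (h ` Q)) ` carrier (G Mod kernel G H h) \<subseteq> carrier H"
    using FactGroup_the_elem_mem by blast
  then have "finite (carrier (G Mod kernel G H h))"
    using assms FactGroup_inj_on inj_on_finite by blast
  then show ?thesis
    by (simp add: FactGroup_def)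
qed

text \<open>Adjoining the carrier makes the intersected family nonempty.\<close>

lemma (in group) subgroup_Mon: "subgroup (Mon G T) G"
proof -
  have "subgroup (\<Inter>(insert (carrier G) {N. N \<lhd> G \<and> closedin T N \<and> N \<noteq> {\<one>}})) G"
    by (rule subgroups_Inter) (auto simp: subgroup_self normal_imp_subgroup)
  then show ?thesis
    by (simp add: Mon_def)
qed

lemma (in group) subgroup_finite_residual: "subgroup (finite_residual G T) G"
proof -
  have "subgroup (\<Inter>(insert (carrier G) {K. subgroup K G \<and> openin T K \<and> group_index G K < \<infinity>})) G"
    by (rule subgroups_Inter) (auto simp: subgroup_self)
  then show ?thesis
    by (simp add: finite_residual_def)
qed

section \<open>Discs and locally approximated homomorphisms\<close>

text \<open>The transfer argument sees a locally finite connected graph with labelled pairs of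
  vertices and a transitive automorphism group; elements of W serve as labels. Transitivity makes
  discs of equal radius equinumerous, which is what turns limits of automorphisms into
  bijections.\<close>

locale homogeneous_chamber_graph =
  fixes S :: "'w set" and Ch :: "'c set" and \<delta> :: "'c \<Rightarrow> 'c \<Rightarrow> 'w"
  assumes locally_finite: "locally_finite_building S Ch \<delta>"
    and adjacency_sym: "\<lbrakk>c \<in> Ch; d \<in> Ch; \<delta> c d \<in> S\<rbrakk> \<Longrightarrow> \<delta> d c \<in> S"
    and adjacency_connected: "\<lbrakk>Y \<subseteq> Ch; Y \<noteq> {};
      \<And>c d. \<lbrakk>c \<in> Y; d \<in> Ch; \<delta> c d \<in> S\<rbrakk> \<Longrightarrow> d \<in> Y\<rbrakk> \<Longrightarrow> Y = Ch"
    and aut_transitive: "\<lbrakk>c \<in> Ch; d \<in> Ch\<rbrakk> \<Longrightarrow> \<exists>g\<in>carrier (aut_group Ch \<delta>). g c = d"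
begin

abbreviation "A \<equiv> aut_group Ch \<delta>"
abbreviation "T \<equiv> aut_topology Ch \<delta>"

sublocale A: group A
  by (rule group_aut_group)

lemmas act_closed = aut_closed[where Ch = Ch and \<delta> = \<delta>]

primrec disc :: "'c \<Rightarrow> nat \<Rightarrow> 'c set" where
  "disc c 0 = {c}"
| "disc c (Suc r) = disc c r \<union> {e \<in> Ch. \<exists>d\<in>disc c r. \<delta> d e \<in> S}"

lemma disc_subset: "c \<in> Ch \<Longrightarrow> disc c r \<subseteq> Ch"
  by (induction r) auto

lemma center_in_disc: "c \<in> disc c r"
  by (induction r) auto

lemma disc_mono: "r \<le> r' \<Longrightarrow> disc c r \<subseteq> disc c r'"
  by (rule lift_Suc_mono_le[of "disc c"]) auto

lemma finite_disc:
  assumes "c \<in> Ch"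
  shows "finite (disc c r)"
proof (induction r)
  case (Suc r)
  have "{e \<in> Ch. \<exists>d\<in>disc c r. \<delta> d e \<in> S} = (\<Union>d\<in>disc c r. {e \<in> Ch. \<delta> d e \<in> S})"
    by blast
  then show ?case
    using Suc locally_finite disc_subset[OF assms, of r] by (auto simp: locally_finite_building_def)
qed simp

lemma disc_trans: "b \<in> disc c m \<Longrightarrow> disc b r \<subseteq> disc c (m + r)"
  by (induction r) auto

lemma disc_Suc_neighbour: "\<lbrakk>d \<in> Ch; \<delta> c d \<in> S\<rbrakk> \<Longrightarrow> disc d r \<subseteq> disc c (Suc r)"
  using disc_trans[of d c 1 r] by simp

lemma disc_sym: "\<lbrakk>c \<in> Ch; b \<in> disc c r\<rbrakk> \<Longrightarrow> c \<in> disc b r"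
proof (induction r arbitrary: b)
  case (Suc r)
  show ?case
  proof (cases "b \<in> disc c r")
    case True
    then show ?thesis
      using Suc disc_mono[of r "Suc r" b] by auto
  next
    case False
    then obtain d where d: "b \<in> Ch" "d \<in> disc c r" "\<delta> d b \<in> S"
      using Suc.prems by auto
    then have "\<delta> b d \<in> S" "d \<in> Ch"
      using adjacency_sym disc_subset[OF Suc.prems(1)] by blast+
    then have "disc d r \<subseteq> disc b (Suc r)"
      by (rule disc_Suc_neighbour[rotated])
    then show ?thesis
      using Suc d by blast
  qed
qed simp

lemma in_some_disc:
  assumes "c \<in> Ch" "d \<in> Ch"
  shows "\<exists>r. d \<in> disc c r"
proof -
  have "{d. \<exists>r. d \<in> disc c r} = Ch"
  proof (rule adjacency_connected)
    show "{d. \<exists>r. d \<in> disc c r} \<subseteq> Ch"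
      using disc_subset assms(1) by blast
    show "{d. \<exists>r. d \<in> disc c r} \<noteq> {}"
      using center_in_disc by blast
    fix d e assume "d \<in> {d. \<exists>r. d \<in> disc c r}" "e \<in> Ch" "\<delta> d e \<in> S"
    then obtain r where "e \<in> disc c (Suc r)"
      by auto
    then show "e \<in> {d. \<exists>r. d \<in> disc c r}"
      by blast
  qed
  then show ?thesis
    using assms(2) by blast
qed

lemma finite_subset_disc:
  assumes "c \<in> Ch" "finite F" "F \<subseteq> Ch"
  shows "\<exists>r. F \<subseteq> disc c r"
  using assms(2,3)
proof (induction F rule: finite_induct)
  case (insert d F)
  then obtain r where "F \<subseteq> disc c r"
    by blast
  moreover obtain r' where "d \<in> disc c r'"
    using in_some_disc assms(1) insert by blast
  ultimately have "insert d F \<subseteq> disc c (max r r')"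
    using disc_mono[of r "max r r'" c] disc_mono[of r' "max r r'" c] by auto
  then show ?case by blast
qed simp

lemma aut_disc:
  assumes "g \<in> carrier A" "c \<in> Ch" "d \<in> disc c r"
  shows "g d \<in> disc (g c) r"
  using assms(3)
proof (induction r arbitrary: d)
  case (Suc r)
  show ?case
  proof (cases "d \<in> disc c r")
    case True
    then show ?thesis using Suc by simp
  next
    case False
    then obtain e where e: "d \<in> Ch" "e \<in> disc c r" "\<delta> e d \<in> S"
      using Suc.prems by auto
    then have "g d \<in> Ch" "g e \<in> disc (g c) r" "\<delta> (g e) (g d) \<in> S"
      using Suc.IH act_closed[OF assms(1)] aut_dist[OF assms(1), of e d] disc_subset[OF assms(2), of r] by auto
    then show ?thesis by auto
  qed
qed simp

lemma aut_mult_disc: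
  assumes "g \<in> carrier A" "h \<in> carrier A" "z \<in> disc c r" "c \<in> Ch"
  shows "(g \<otimes>\<^bsub>A\<^esub> h) z = g (h z)"
  using assms disc_subset by (intro aut_mult_apply) auto

text \<open>The value at l is the coset of any h in H that agrees with \<open>\<psi> l\<close> on
  some disc of radius R. Two elements of H that agree on such a disc differ by an element of N
  wherever the disc lies, because H is transitive and N is normal.\<close>

lemma approximation_hom:
  fixes H N :: "('c \<Rightarrow> 'c) set" and G :: "('g, 'm) monoid_scheme"
  assumes H: "subgroup H A" and H_trans: "\<And>c d. \<lbrakk>c \<in> Ch; d \<in> Ch\<rbrakk> \<Longrightarrow> \<exists>h\<in>H. h c = d"
    and N: "N \<lhd> A\<lparr>carrier := H\<rparr>" and "b \<in> Ch"
    and stab: "\<And>h. \<lbrakk>h \<in> H; \<And>z. z \<in> disc b R \<Longrightarrow> h z = z\<rbrakk> \<Longrightarrow> h \<in> N"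
    and "group G" and \<psi>: "\<psi> \<in> hom G A"
    and approx: "\<And>l c. \<lbrakk>l \<in> carrier G; c \<in> Ch\<rbrakk> \<Longrightarrow> \<exists>h\<in>H. \<forall>z\<in>disc c (Suc R). h z = \<psi> l z"
  shows "\<exists>\<phi>\<in>hom G (A\<lparr>carrier := H\<rparr> Mod N).
    \<forall>l\<in>carrier G. \<forall>h\<in>H. (\<forall>z\<in>disc b R. h z = \<psi> l z) \<longrightarrow> \<phi> l = N #>\<^bsub>A\<lparr>carrier := H\<rparr>\<^esub> h"
proof -
  let ?H = "A\<lparr>carrier := H\<rparr>"
  interpret H: group ?H
    using H by (rule A.subgroup_imp_group)
  interpret N: normal N ?H
    by (rule N)
  have HA: "h \<in> H \<Longrightarrow> h \<in> carrier A" for h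
    using H subgroup.subset by blast
  have NH: "N \<subseteq> H"
    using N.subset by simp
  note H_closed = subgroup.m_closed[OF H] subgroup.m_inv_closed[OF H]
  have inv_H: "inv\<^bsub>?H\<^esub> h = inv\<^bsub>A\<^esub> h" if "h \<in> H" for h
    using H that by (rule A.m_inv_consistent)
  have stab': "h \<in> N" if h: "h \<in> H" "c \<in> Ch" "\<And>z. z \<in> disc c R \<Longrightarrow> h z = z" for h c
  proof -
    obtain g where g: "g \<in> H" "g b = c"
      using H_trans[OF \<open>b \<in> Ch\<close> h(2)] by blast
    have "inv\<^bsub>A\<^esub> g \<otimes>\<^bsub>A\<^esub> (h \<otimes>\<^bsub>A\<^esub> g) \<in> N"
    proof (rule stab)
      show "inv\<^bsub>A\<^esub> g \<otimes>\<^bsub>A\<^esub> (h \<otimes>\<^bsub>A\<^esub> g) \<in> H"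
        using g h H_closed by simp
      fix z assume z: "z \<in> disc b R"
      then have "z \<in> Ch" "h (g z) = g z"
        using disc_subset[OF \<open>b \<in> Ch\<close>] h(3)[of "g z"] aut_disc[of g b z R] HA g \<open>b \<in> Ch\<close> by auto
      then show "(inv\<^bsub>A\<^esub> g \<otimes>\<^bsub>A\<^esub> (h \<otimes>\<^bsub>A\<^esub> g)) z = z"
        using HA g h aut_inv_apply(1)[of g Ch \<delta> z] by (simp add: aut_mult_apply)
    qed
    then have "g \<otimes>\<^bsub>A\<^esub> (inv\<^bsub>A\<^esub> g \<otimes>\<^bsub>A\<^esub> (h \<otimes>\<^bsub>A\<^esub> g)) \<otimes>\<^bsub>A\<^esub> inv\<^bsub>A\<^esub> g \<in> N"
      using N.inv_op_closed2[of g] g inv_H by simp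
    moreover have "g \<otimes>\<^bsub>A\<^esub> (inv\<^bsub>A\<^esub> g \<otimes>\<^bsub>A\<^esub> (h \<otimes>\<^bsub>A\<^esub> g)) = h \<otimes>\<^bsub>A\<^esub> g"
      using HA g h by (simp add: A.m_assoc[symmetric])
    moreover have "h \<otimes>\<^bsub>A\<^esub> g \<otimes>\<^bsub>A\<^esub> inv\<^bsub>A\<^esub> g = h"
      using HA g h by (simp add: A.m_assoc)
    ultimately show ?thesis
      by simp
  qed
  have coset_eqI: "N #>\<^bsub>?H\<^esub> h = N #>\<^bsub>?H\<^esub> h'"
    if h: "h \<in> H" "h' \<in> H" "c \<in> Ch" "\<And>z. z \<in> disc c R \<Longrightarrow> h z = h' z" for h h' c
  proof -
    have "h \<otimes>\<^bsub>A\<^esub> inv\<^bsub>A\<^esub> h' \<in> N"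
    proof (rule stab'[of _ "h' c"])
      show "h \<otimes>\<^bsub>A\<^esub> inv\<^bsub>A\<^esub> h' \<in> H" "h' c \<in> Ch"
        using h H_closed HA act_closed by auto
      fix z assume z: "z \<in> disc (h' c) R"
      have "(inv\<^bsub>A\<^esub> h') z \<in> disc ((inv\<^bsub>A\<^esub> h') (h' c)) R"
        by (rule aut_disc) (use z h HA act_closed in auto)
      then have "h ((inv\<^bsub>A\<^esub> h') z) = h' ((inv\<^bsub>A\<^esub> h') z)"
        using h HA aut_inv_apply(1)[of h' Ch \<delta> c] by simp
      moreover have "z \<in> Ch"
        using z disc_subset[of "h' c" R] h HA act_closed by blast
      ultimately show "(h \<otimes>\<^bsub>A\<^esub> inv\<^bsub>A\<^esub> h') z = z"
        using h HA by (simp add: aut_mult_apply aut_inv_apply)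
    qed
    moreover have "h \<otimes>\<^bsub>A\<^esub> inv\<^bsub>A\<^esub> h' \<otimes>\<^bsub>A\<^esub> h' = h"
      using h HA by (simp add: A.m_assoc)
    ultimately have "h \<in> N #>\<^bsub>?H\<^esub> h'"
      by (auto simp: r_coset_def intro: bexI[of _ "h \<otimes>\<^bsub>A\<^esub> inv\<^bsub>A\<^esub> h'"])
    then show ?thesis
      using H.repr_independence[OF _ _ N.subgroup_axioms] h by auto
  qed
  text \<open>The coset of an approximation of l does not depend on where the approximation is good:
    approximations at adjacent chambers can be compared with a common one.\<close>
  have coset_unique: "N #>\<^bsub>?H\<^esub> h = N #>\<^bsub>?H\<^esub> h'"
    if l: "l \<in> carrier G" and h: "h \<in> H" "c \<in> Ch" "\<forall>z\<in>disc c R. h z = \<psi> l z"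
      and h': "h' \<in> H" "c' \<in> Ch" "\<forall>z\<in>disc c' R. h' z = \<psi> l z" for l h h' c c'
  proof -
    let ?Y = "{e \<in> Ch. \<forall>k\<in>H. (\<forall>z\<in>disc e R. k z = \<psi> l z) \<longrightarrow> N #>\<^bsub>?H\<^esub> h = N #>\<^bsub>?H\<^esub> k}"
    have "?Y = Ch"
    proof (rule adjacency_connected)
      have "c \<in> ?Y"
      proof (intro CollectI conjI ballI impI)
        fix k assume "k \<in> H" "\<forall>z\<in>disc c R. k z = \<psi> l z"
        then show "N #>\<^bsub>?H\<^esub> h = N #>\<^bsub>?H\<^esub> k"
          by (intro coset_eqI[of h k c]) (simp_all add: h)
      qed (rule h)
      then show "?Y \<noteq> {}" by blast
      fix d e assume d: "d \<in> ?Y" and e: "e \<in> Ch" "\<delta> d e \<in> S"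
      obtain k where k: "k \<in> H" "\<forall>z\<in>disc d (Suc R). k z = \<psi> l z"
        using approx[of l d] l d by blast
      have "disc e R \<subseteq> disc d (Suc R)" "disc d R \<subseteq> disc d (Suc R)"
        using disc_Suc_neighbour e by auto
      then have k': "\<forall>z\<in>disc e R. k z = \<psi> l z" "\<forall>z\<in>disc d R. k z = \<psi> l z"
        using k by blast+
      then have "N #>\<^bsub>?H\<^esub> h = N #>\<^bsub>?H\<^esub> k"
        using d k by blast
      moreover have "N #>\<^bsub>?H\<^esub> k = N #>\<^bsub>?H\<^esub> k'" if "k' \<in> H" "\<forall>z\<in>disc e R. k' z = \<psi> l z" for k'
        by (rule coset_eqI[of k k' e]) (use that k k' e in simp_all)
      ultimately show "e \<in> ?Y"
        using e by auto
    qed blast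
    then show ?thesis
      using h' by blast
  qed
  define P where "P l h \<longleftrightarrow> h \<in> H \<and> (\<forall>z\<in>disc b R. h z = \<psi> l z)" for l h
  define \<phi> where "\<phi> l = N #>\<^bsub>?H\<^esub> (SOME h. P l h)" for l
  have approx': "\<exists>h\<in>H. \<forall>z\<in>disc c R. h z = \<psi> l z" if "l \<in> carrier G" "c \<in> Ch" for l c
  proof -
    have "disc c R \<subseteq> disc c (Suc R)"
      by auto
    then show ?thesis
      using approx[OF that] by blast
  qed
  have \<phi>: "\<phi> l = N #>\<^bsub>?H\<^esub> h"
    if l: "l \<in> carrier G" "h \<in> H" "c \<in> Ch" "\<forall>z\<in>disc c R. h z = \<psi> l z" for l h c
  proof -
    have "\<exists>h. P l h"
      using approx'[OF l(1) \<open>b \<in> Ch\<close>] unfolding P_def by blast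
    then have "P l (SOME h. P l h)"
      by (rule someI_ex)
    then have "(SOME h. P l h) \<in> H" "\<forall>z\<in>disc b R. (SOME h. P l h) z = \<psi> l z"
      unfolding P_def by blast+
    then show ?thesis
      unfolding \<phi>_def by (intro coset_unique[OF l(1) _ \<open>b \<in> Ch\<close> _ l(2-4)])
  qed
  have "\<phi> \<in> hom G (?H Mod N)"
  proof (rule homI)
    fix l assume l: "l \<in> carrier G"
    then obtain h where h: "h \<in> H" "\<forall>z\<in>disc b R. h z = \<psi> l z"
      using approx'[OF l \<open>b \<in> Ch\<close>] by blast
    then show "\<phi> l \<in> carrier (?H Mod N)"
      using \<phi>[OF l h(1) \<open>b \<in> Ch\<close> h(2)] by (auto simp: FactGroup_def RCOSETS_def)
  next
    fix l m assume l: "l \<in> carrier G" and m: "m \<in> carrier G"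
    have \<psi>A: "\<psi> l \<in> carrier A" "\<psi> m \<in> carrier A" and \<psi>_mult: "\<psi> (l \<otimes>\<^bsub>G\<^esub> m) = \<psi> l \<otimes>\<^bsub>A\<^esub> \<psi> m"
      using \<psi> l m by (auto simp: hom_def)
    have lm: "l \<otimes>\<^bsub>G\<^esub> m \<in> carrier G"
      using l m \<open>group G\<close> by (simp add: group.is_monoid monoid.m_closed)
    obtain k where k: "k \<in> H" "\<forall>z\<in>disc b R. k z = \<psi> m z"
      using approx'[OF m \<open>b \<in> Ch\<close>] by blast
    have mb: "\<psi> m b \<in> Ch"
      using \<psi>A \<open>b \<in> Ch\<close> act_closed by blast
    \<comment> \<open>\<open>\<psi> l\<close> is approximated at the image of b under
      \<open>\<psi> m\<close>, so that the product of the two approximations approximates the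
      product at b.\<close>
    obtain h where h: "h \<in> H" "\<forall>z\<in>disc (\<psi> m b) R. h z = \<psi> l z"
      using approx'[OF l mb] by blast
    have "\<forall>z\<in>disc b R. (h \<otimes>\<^bsub>A\<^esub> k) z = \<psi> (l \<otimes>\<^bsub>G\<^esub> m) z"
    proof
      fix z assume z: "z \<in> disc b R"
      then have "\<psi> m z \<in> disc (\<psi> m b) R"
        using aut_disc \<psi>A \<open>b \<in> Ch\<close> by blast
      then show "(h \<otimes>\<^bsub>A\<^esub> k) z = \<psi> (l \<otimes>\<^bsub>G\<^esub> m) z"
        using z h k \<psi>A HA \<psi>_mult aut_mult_disc[OF _ _ z \<open>b \<in> Ch\<close>] by simp
    qed
    then have "\<phi> (l \<otimes>\<^bsub>G\<^esub> m) = N #>\<^bsub>?H\<^esub> (h \<otimes>\<^bsub>A\<^esub> k)"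
      using \<phi>[OF lm] H_closed h k \<open>b \<in> Ch\<close> by blast
    also have "\<dots> = (N #>\<^bsub>?H\<^esub> h) <#>\<^bsub>?H\<^esub> (N #>\<^bsub>?H\<^esub> k)"
      using N.rcos_sum[of h k] h k by simp
    also have "\<dots> = \<phi> l \<otimes>\<^bsub>?H Mod N\<^esub> \<phi> m"
      using \<phi>[OF l h(1) mb h(2)] \<phi>[OF m k(1) \<open>b \<in> Ch\<close> k(2)] by (simp add: FactGroup_def)
    finally show "\<phi> (l \<otimes>\<^bsub>G\<^esub> m) = \<phi> l \<otimes>\<^bsub>?H Mod N\<^esub> \<phi> m" .
  qed
  then show ?thesis
    using \<phi> \<open>b \<in> Ch\<close> by blast
qed

end

section \<open>Compactness and Chabauty limits\<close>

context homogeneous_chamber_graph begin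

lemma openin_cylinder:
  assumes "finite F" "F \<subseteq> Ch"
  shows "openin T {g \<in> carrier A. \<forall>z\<in>F. g z = f z}"
  using assms unfolding openin_aut_topology_iff by (auto intro!: exI[of _ F])

text \<open>By local finiteness a bound on \<open>g b\<close> bounds every \<open>g c\<close>, which
  places the set in a compact product of finite sets. Closedness is the real point: a pointwise
  limit of automorphisms must be surjective, and this is checked disc by disc by counting.\<close>

lemma compactin_bounded:
  assumes "b \<in> Ch" "finite B" "B \<subseteq> Ch"
  shows "compactin T {g \<in> carrier A. g b \<in> B}"
proof -
  let ?P = "product_topology (\<lambda>_. discrete_topology Ch) Ch"
  obtain r where r: "\<And>c. c \<in> Ch \<Longrightarrow> c \<in> disc b (r c)"
    using in_some_disc[OF assms(1)] by metis
  \<comment> \<open>An automorphism g maps the disc of radius \<open>r c\<close> about b, which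
    contains c, into the disc of the same radius about \<open>g b\<close>.\<close>
  define Q where "Q c = (\<Union>d\<in>B. disc d (r c))" for c
  have Q: "finite (Q c)" "Q c \<subseteq> Ch" for c
    using assms finite_disc disc_subset unfolding Q_def by blast+
  define C where "C = {g \<in> carrier A. g b \<in> B}"
  have "compactin ?P (PiE Ch Q)"
    using Q by (simp add: compactin_PiE compactin_discrete_topology)
  moreover have C_Q: "C \<subseteq> PiE Ch Q"
  proof
    fix g assume g: "g \<in> C"
    then have "g c \<in> Q c" if "c \<in> Ch" for c
      using aut_disc[OF _ assms(1) r[OF that], of g] unfolding C_def Q_def by blast
    moreover have "g \<in> extensional Ch"
      using g by (simp add: C_def aut_carrier_iff)
    ultimately show "g \<in> PiE Ch Q"
      by (simp add: PiE_def)
  qed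
  moreover have "closedin ?P C"
  proof -
    have CP: "C \<subseteq> Ch \<rightarrow>\<^sub>E Ch"
      using aut_carrier_PiE unfolding C_def by blast
    have "\<exists>F. finite F \<and> F \<subseteq> Ch \<and> (\<forall>g\<in>Ch \<rightarrow>\<^sub>E Ch. (\<forall>z\<in>F. g z = f z) \<longrightarrow> g \<notin> C)"
      if f: "f \<in> Ch \<rightarrow>\<^sub>E Ch" "f \<notin> C" for f
    proof (rule ccontr)
      assume "\<not> ?thesis"
      then have approx: "\<exists>g\<in>C. \<forall>z\<in>F. g z = f z" if "finite F" "F \<subseteq> Ch" for F
        using that by blast
      have f_Ch: "f c \<in> Ch" if "c \<in> Ch" for c
        using f(1) that by blast
      have fb: "f b \<in> B"
        using approx[of "{b}"] assms(1) unfolding C_def by auto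
      have dist: "\<delta> (f c) (f d) = \<delta> c d" "f c = f d \<longleftrightarrow> c = d" if cd: "c \<in> Ch" "d \<in> Ch" for c d
      proof -
        obtain g where "g \<in> C" "\<forall>z\<in>{c, d}. g z = f z"
          using approx[of "{c, d}"] cd by auto
        then show "\<delta> (f c) (f d) = \<delta> c d" "f c = f d \<longleftrightarrow> c = d"
          using cd aut_dist[of g Ch \<delta> c d] aut_inj[of g Ch \<delta> c d] unfolding C_def by auto
      qed
      obtain k where k: "k \<in> carrier A" "k b = f b"
        using aut_transitive[OF assms(1)] f_Ch assms(1) by blast
      text \<open>f is injective and maps a disc around b into the disc around f b, which has the same
        finite number of chambers because k maps b to f b.\<close>
      have "f ` disc b n = disc (f b) n" for n
      proof (rule card_subset_eq)
        show "finite (disc (f b) n)"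
          using finite_disc f_Ch assms(1) by blast
        show sub: "f ` disc b n \<subseteq> disc (f b) n"
        proof
          fix y assume "y \<in> f ` disc b n"
          then obtain z where z: "z \<in> disc b n" "y = f z"
            by blast
          obtain g where "g \<in> C" "\<forall>z\<in>{b, z}. g z = f z"
            using approx[of "{b, z}"] assms(1) z disc_subset[OF assms(1)] by auto
          then show "y \<in> disc (f b) n"
            using aut_disc[of g b z n] assms(1) z unfolding C_def by auto
        qed
        have "inj_on k (disc b n)" "inj_on f (disc b n)"
          using aut_inj[OF k(1)] dist(2) disc_subset[OF assms(1)] by (auto simp: inj_on_def subset_iff)
        moreover have "k ` disc b n = disc (f b) n"
        proof
          show "k ` disc b n \<subseteq> disc (f b) n"
            using aut_disc[OF k(1) assms(1)] k(2) by auto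
          show "disc (f b) n \<subseteq> k ` disc b n"
          proof
            fix y assume y: "y \<in> disc (f b) n"
            then have "(inv\<^bsub>A\<^esub> k) y \<in> disc ((inv\<^bsub>A\<^esub> k) (k b)) n"
              using k f_Ch[OF assms(1)] aut_disc[of "inv\<^bsub>A\<^esub> k" "f b" y n] by simp
            then have "(inv\<^bsub>A\<^esub> k) y \<in> disc b n"
              using aut_inv_apply(1)[OF k(1) assms(1)] by simp
            moreover have "y = k ((inv\<^bsub>A\<^esub> k) y)"
              using aut_inv_apply(2)[OF k(1), of y] y disc_subset[OF f_Ch[OF assms(1)], of n] by auto
            ultimately show "y \<in> k ` disc b n"
              by blast
          qed
        qed
        ultimately show "card (f ` disc b n) = card (disc (f b) n)"
          by (metis card_image)
      qed
      note img = this[symmetric]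
      have "f ` Ch = Ch"
      proof
        show "f ` Ch \<subseteq> Ch"
          using f_Ch by (rule image_subsetI)
        show "Ch \<subseteq> f ` Ch"
        proof
          fix y assume "y \<in> Ch"
          then obtain n where "y \<in> disc (f b) n"
            using in_some_disc[OF f_Ch[OF assms(1)]] by blast
          then show "y \<in> f ` Ch"
            unfolding img using disc_subset[OF assms(1), of n] by auto
        qed
      qed
      then have "f \<in> carrier A"
        using dist f(1) by (auto simp: aut_carrier_iff bij_betw_def inj_on_def PiE_def)
      then show False
        using f(2) fb by (simp add: C_def)
    qed
    then have "openin ?P ((Ch \<rightarrow>\<^sub>E Ch) - C)"
      using openin_pointwise_iff[OF order_refl, of Ch Ch "(Ch \<rightarrow>\<^sub>E Ch) - C"]
      by (simp add: subtopology_superset)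
    then show ?thesis
      using CP by (simp add: closedin_def)
  qed
  ultimately have "compactin ?P C"
    using closed_compactin by blast
  then show ?thesis
    unfolding C_def by (auto simp: aut_topology_def compactin_subtopology)
qed

text \<open>Otherwise each element of the stabiliser would have a cylinder that the sequence
  eventually avoids, and finitely many of these cover the compact stabiliser. A cluster point of the
  whole sequence spares the choice of a subsequence.\<close>

lemma cluster_point_in_stabilizer:
  assumes "b \<in> Ch" and \<sigma>: "\<forall>\<^sub>F n in sequentially. \<sigma> n \<in> carrier A \<and> \<sigma> n b = b"
  shows "\<exists>\<tau>\<in>carrier A. \<tau> b = b \<and>
    (\<forall>F. finite F \<longrightarrow> F \<subseteq> Ch \<longrightarrow> (\<exists>\<^sub>F n in sequentially. \<forall>z\<in>F. \<sigma> n z = \<tau> z))"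
proof (rule ccontr)
  assume "\<not> ?thesis"
  then have "\<forall>g\<in>{g \<in> carrier A. g b \<in> {b}}. \<exists>F. finite F \<and> F \<subseteq> Ch \<and> (\<forall>\<^sub>F n in sequentially. \<not> (\<forall>z\<in>F. \<sigma> n z = g z))"
    unfolding frequently_def by (auto simp: imp_conjL)
  from bchoice[OF this] obtain F where F: "\<forall>g\<in>{g \<in> carrier A. g b \<in> {b}}.
      finite (F g) \<and> F g \<subseteq> Ch \<and> (\<forall>\<^sub>F n in sequentially. \<not> (\<forall>z\<in>F g. \<sigma> n z = g z))"
    by (rule exE)
  let ?K = "{g \<in> carrier A. g b \<in> {b}}"
  define U where "U g = {x \<in> carrier A. \<forall>z\<in>F g. x z = g z}" for g
  have "\<forall>V\<in>U ` ?K. openin T V"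
    using F openin_cylinder unfolding U_def by auto
  moreover have "?K \<subseteq> \<Union> (U ` ?K)"
    unfolding U_def by auto
  moreover have "compactin T ?K"
    using compactin_bounded[OF assms(1), of "{b}"] assms(1) by blast
  ultimately have "\<exists>\<F>. finite \<F> \<and> \<F> \<subseteq> U ` ?K \<and> ?K \<subseteq> \<Union> \<F>"
    unfolding compactin_def by (elim conjE allE[of _ "U ` ?K"]) simp
  then obtain \<F> where "finite \<F>" "\<F> \<subseteq> U ` ?K" "?K \<subseteq> \<Union> \<F>"
    by (elim exE conjE)
  then obtain G where G: "G \<subseteq> ?K" "finite G" "?K \<subseteq> \<Union> (U ` G)"
    using finite_subset_image[of \<F> U ?K] by auto
  have "\<forall>\<^sub>F n in sequentially. \<forall>g\<in>G. \<not> (\<forall>z\<in>F g. \<sigma> n z = g z)"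
    using F G by (intro eventually_ball_finite) auto
  then have "\<forall>\<^sub>F n in sequentially. False"
    using \<sigma>
  proof eventually_elim
    case (elim n)
    then have "\<sigma> n \<in> ?K" by simp
    then obtain g where "g \<in> G" "\<sigma> n \<in> U g"
      using G(3) by blast
    then show False
      using elim unfolding U_def by blast
  qed
  then show False by simp
qed

text \<open>The automorphisms agreeing with h on F form an open set that H hits, and hitting an open
  set is an open condition.\<close>

lemma chabauty_limit_upper:
  assumes "limitin (chabauty_topology A T) Hs H sequentially" "H \<in> closed_subgroups A T"
    and "h \<in> H" "finite F" "F \<subseteq> Ch"
  shows "\<forall>\<^sub>F n in sequentially. \<exists>l\<in>Hs n. \<forall>z\<in>F. l z = h z"
proof -
  let ?U = "{g \<in> carrier A. \<forall>z\<in>F. g z = h z}"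
  have "openin (chabauty_topology A T) {L \<in> closed_subgroups A T. L \<inter> ?U \<noteq> {}}"
    unfolding chabauty_topology_def
    by (rule topology_generated_by_Basis) (use openin_cylinder[OF assms(4,5)] in blast)
  moreover have "h \<in> ?U"
    using assms(2,3) subgroup.subset unfolding closed_subgroups_def by fastforce
  then have "H \<in> {L \<in> closed_subgroups A T. L \<inter> ?U \<noteq> {}}"
    using assms(2,3) by blast
  ultimately have "\<forall>\<^sub>F n in sequentially. Hs n \<in> {L \<in> closed_subgroups A T. L \<inter> ?U \<noteq> {}}"
    using assms(1) unfolding limitin_def by blast
  then show ?thesis
    by (rule eventually_mono) blast
qed

text \<open>The automorphisms that move b into B and agree with no element of H on F form a compact
  set disjoint from H, and missing a compact set is an open condition. The bound on
  \<open>l b\<close> is what makes this set compact.\<close>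

lemma chabauty_limit_lower:
  assumes "limitin (chabauty_topology A T) Hs H sequentially" "H \<in> closed_subgroups A T"
    and "b \<in> Ch" "finite B" "B \<subseteq> Ch" "finite F" "F \<subseteq> Ch"
  shows "\<forall>\<^sub>F n in sequentially. \<forall>l\<in>Hs n. l b \<in> B \<longrightarrow> (\<exists>h\<in>H. \<forall>z\<in>F. h z = l z)"
proof -
  let ?V = "\<Union>h\<in>H. {g \<in> carrier A. \<forall>z\<in>F. g z = h z}"
  let ?K = "{g \<in> carrier A. g b \<in> B} - ?V"
  have HA: "H \<subseteq> carrier A"
    using assms(2) subgroup.subset unfolding closed_subgroups_def by blast
  have "openin T ?V"
    using openin_cylinder[OF assms(6,7)] by blast
  then have "closedin T (topspace T - ?V)"
    by blast
  then have "compactin T ({g \<in> carrier A. g b \<in> B} \<inter> (topspace T - ?V))"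
    using compactin_bounded[OF assms(3-5)] by (rule compact_Int_closedin[rotated])
  moreover have "{g \<in> carrier A. g b \<in> B} \<inter> (topspace T - ?V) = ?K"
    by (auto simp: topspace_aut_topology)
  ultimately have "compactin T ?K"
    by simp
  then have "openin (chabauty_topology A T) {L \<in> closed_subgroups A T. L \<inter> ?K = {}}"
    unfolding chabauty_topology_def by (intro topology_generated_by_Basis) blast
  moreover have "H \<in> {L \<in> closed_subgroups A T. L \<inter> ?K = {}}"
    using assms(2) HA by blast
  ultimately have "\<forall>\<^sub>F n in sequentially. Hs n \<in> {L \<in> closed_subgroups A T. L \<inter> ?K = {}}"
    using assms(1) unfolding limitin_def by blast
  then show ?thesis
  proof (rule eventually_mono)
    fix n assume n: "Hs n \<in> {L \<in> closed_subgroups A T. L \<inter> ?K = {}}"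
    then have "Hs n \<subseteq> carrier A"
      using subgroup.subset unfolding closed_subgroups_def by blast
    then have "l \<in> ?V" if "l \<in> Hs n" "l b \<in> B" for l
      using n that by blast
    then show "\<forall>l\<in>Hs n. l b \<in> B \<longrightarrow> (\<exists>h\<in>H. \<forall>z\<in>F. h z = l z)"
      by fastforce
  qed
qed

end

section \<open>Open normal subgroups of finite index\<close>

context homogeneous_chamber_graph begin

text \<open>The approximating homomorphism from L to H/N has an open kernel of finite index, which
  contains the finite residual; lifts of distinct elements of P to L have distinct images.
  Conjugation by \<theta> is absorbed into the homomorphism, so that L keeps its own
  topology.\<close>

lemma group_index_finite_residual_ge:
  fixes H N L P :: "('c \<Rightarrow> 'c) set"
  assumes H: "subgroup H A" and H_trans: "\<And>c d. \<lbrakk>c \<in> Ch; d \<in> Ch\<rbrakk> \<Longrightarrow> \<exists>h\<in>H. h c = d"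
    and N: "N \<lhd> A\<lparr>carrier := H\<rparr>" "finite (rcosets\<^bsub>A\<lparr>carrier := H\<rparr>\<^esub> N)" and b: "b \<in> Ch"
    and stab: "\<And>h. \<lbrakk>h \<in> H; \<And>z. z \<in> disc b R \<Longrightarrow> h z = z\<rbrakk> \<Longrightarrow> h \<in> N"
    and L: "subgroup L A" and \<theta>: "\<theta> \<in> carrier A"
    and approx: "\<And>l c. \<lbrakk>l \<in> L; c \<in> Ch\<rbrakk> \<Longrightarrow>
      \<exists>h\<in>H. \<forall>z\<in>disc c (Suc R). h z = (\<theta> \<otimes>\<^bsub>A\<^esub> l \<otimes>\<^bsub>A\<^esub> inv\<^bsub>A\<^esub> \<theta>) z"
    and P: "P \<subseteq> H" "finite P" "\<And>x y. \<lbrakk>x \<in> P; y \<in> P; x \<noteq> y\<rbrakk> \<Longrightarrow> x \<otimes>\<^bsub>A\<^esub> inv\<^bsub>A\<^esub> y \<notin> N"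
    and lift: "\<And>h. h \<in> P \<Longrightarrow> \<exists>l\<in>L. \<forall>z\<in>disc b R. h z = (\<theta> \<otimes>\<^bsub>A\<^esub> l \<otimes>\<^bsub>A\<^esub> inv\<^bsub>A\<^esub> \<theta>) z"
  shows "enat (card P) \<le> group_index (A\<lparr>carrier := L\<rparr>)
    (finite_residual (A\<lparr>carrier := L\<rparr>) (subtopology T L))"
proof -
  let ?H = "A\<lparr>carrier := H\<rparr>" and ?L = "A\<lparr>carrier := L\<rparr>"
  define \<psi> where "\<psi> l = \<theta> \<otimes>\<^bsub>A\<^esub> l \<otimes>\<^bsub>A\<^esub> inv\<^bsub>A\<^esub> \<theta>" for l
  interpret H: group ?H
    using H by (rule A.subgroup_imp_group)
  interpret L: group ?L
    using L by (rule A.subgroup_imp_group)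
  interpret N: normal N ?H
    by (rule N(1))
  have HA: "h \<in> H \<Longrightarrow> h \<in> carrier A" and LA: "l \<in> L \<Longrightarrow> l \<in> carrier A" for h l
    using H L subgroup.subset by blast+
  have \<psi>: "\<psi> \<in> hom ?L A"
  proof (rule homI)
    fix l m assume "l \<in> carrier ?L" "m \<in> carrier ?L"
    then have lm: "l \<in> carrier A" "m \<in> carrier A"
      using LA by auto
    then have "inv\<^bsub>A\<^esub> \<theta> \<otimes>\<^bsub>A\<^esub> (\<theta> \<otimes>\<^bsub>A\<^esub> (m \<otimes>\<^bsub>A\<^esub> inv\<^bsub>A\<^esub> \<theta>)) = m \<otimes>\<^bsub>A\<^esub> inv\<^bsub>A\<^esub> \<theta>"
      using \<theta> by (simp add: A.m_assoc[symmetric])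
    with lm show "\<psi> (l \<otimes>\<^bsub>?L\<^esub> m) = \<psi> l \<otimes>\<^bsub>A\<^esub> \<psi> m"
      using \<theta> by (simp add: \<psi>_def A.m_assoc)
  qed (use \<theta> LA in \<open>simp add: \<psi>_def\<close>)
  obtain \<phi> where \<phi>: "\<phi> \<in> hom ?L (?H Mod N)"
    and \<phi>_eq: "\<And>l h. \<lbrakk>l \<in> L; h \<in> H; \<forall>z\<in>disc b R. h z = \<psi> l z\<rbrakk> \<Longrightarrow> \<phi> l = N #>\<^bsub>?H\<^esub> h"
  proof -
    have "\<exists>h\<in>H. \<forall>z\<in>disc c (Suc R). h z = \<psi> l z" if "l \<in> carrier ?L" "c \<in> Ch" for l c
      using approx[of l c] that unfolding \<psi>_def by simp
    from approximation_hom[OF H H_trans N(1) b stab L.is_group \<psi> this]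
    obtain \<phi> where "\<phi> \<in> hom ?L (?H Mod N)"
      "\<forall>l\<in>carrier ?L. \<forall>h\<in>H. (\<forall>z\<in>disc b R. h z = \<psi> l z) \<longrightarrow> \<phi> l = N #>\<^bsub>?H\<^esub> h"
      by (rule bexE)
    then show ?thesis
      by (intro that[of \<phi>]) simp_all
  qed
  interpret \<phi>: group_hom ?L "?H Mod N" \<phi>
    using L.is_group N.factorgroup_is_group \<phi>
    by (intro group_hom.intro group_hom_axioms.intro)
  define K where "K = kernel ?L (?H Mod N) \<phi>"
  have K_L: "subgroup K ?L"
    unfolding K_def by (rule \<phi>.subgroup_kernel)
  have "finite (rcosets\<^bsub>?L\<^esub> K)"
    unfolding K_def using N(2) by (intro \<phi>.finite_rcosets_kernel) (simp add: FactGroup_def)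
  then have "group_index ?L K < \<infinity>"
    by (simp add: group_index_def)
  moreover have "openin (subtopology T L) K"
  proof (rule openin_aut_subgroup[OF L A.incl_subgroup[OF L K_L]])
    show "K \<subseteq> L"
      using subgroup.subset[OF K_L] by simp
    \<comment> \<open>An l fixing these chambers has a conjugate fixing \<open>disc b R\<close>,
      which the identity of H approximates.\<close>
    let ?F = "(inv\<^bsub>A\<^esub> \<theta>) ` disc b R"
    show "finite ?F" "?F \<subseteq> Ch"
      using finite_disc[OF b] disc_subset[OF b] act_closed A.inv_closed[OF \<theta>] by blast+
    fix l assume l: "l \<in> L" "\<And>z. z \<in> ?F \<Longrightarrow> l z = z"
    have "\<one>\<^bsub>A\<^esub> z = \<psi> l z" if "z \<in> disc b R" for z
    proof -
      have "z \<in> Ch"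
        using that disc_subset[OF b] by blast
      then show ?thesis
        using l that \<theta> LA by (simp add: \<psi>_def aut_mult_apply act_closed aut_inv_apply aut_one_apply)
    qed
    then have "\<phi> l = N #>\<^bsub>?H\<^esub> \<one>\<^bsub>?H\<^esub>"
      using \<phi>_eq[OF l(1), of "\<one>\<^bsub>A\<^esub>"] H.one_closed by simp
    then have "\<phi> l = \<one>\<^bsub>?H Mod N\<^esub>"
      using H.coset_mult_one[OF N.subset] by (simp add: FactGroup_def)
    then show "l \<in> K"
      using l(1) unfolding K_def kernel_def by simp
  qed
  ultimately have residual: "finite_residual ?L (subtopology T L) \<subseteq> K"
    using K_L unfolding finite_residual_def by blast
  obtain f where f: "\<And>h. h \<in> P \<Longrightarrow> f h \<in> L \<and> (\<forall>z\<in>disc b R. h z = \<psi> (f h) z)"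
    using lift unfolding \<psi>_def by metis
  have f_K: "f x \<otimes>\<^bsub>?L\<^esub> inv\<^bsub>?L\<^esub> (f y) \<notin> K" if xy: "x \<in> P" "y \<in> P" "x \<noteq> y" for x y
  proof
    assume "f x \<otimes>\<^bsub>?L\<^esub> inv\<^bsub>?L\<^esub> (f y) \<in> K"
    moreover have fL: "f x \<in> carrier ?L" "f y \<in> carrier ?L"
      using f xy by auto
    moreover have "f x = f x \<otimes>\<^bsub>?L\<^esub> inv\<^bsub>?L\<^esub> (f y) \<otimes>\<^bsub>?L\<^esub> f y"
      using fL L.m_assoc[of "f x" "inv\<^bsub>?L\<^esub> (f y)" "f y"] L.l_inv[of "f y"] L.r_one[of "f x"] L.inv_closed[of "f y"] by metis
    ultimately have "\<phi> (f x) = \<one>\<^bsub>?H Mod N\<^esub> \<otimes>\<^bsub>?H Mod N\<^esub> \<phi> (f y)"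
      using \<phi>.hom_mult[of "f x \<otimes>\<^bsub>?L\<^esub> inv\<^bsub>?L\<^esub> (f y)" "f y"] unfolding K_def kernel_def by auto
    then have "\<phi> (f x) = \<phi> (f y)"
      using \<phi>.H.l_one[OF \<phi>.hom_closed[OF fL(2)]] by metis
    then have "N #>\<^bsub>?H\<^esub> x = N #>\<^bsub>?H\<^esub> y"
      using \<phi>_eq f xy P(1) by blast
    then have "x \<in> N #>\<^bsub>?H\<^esub> y"
      using H.rcos_self[OF _ N.subgroup_axioms, of x] xy P(1) by auto
    then obtain k where k: "k \<in> N" "x = k \<otimes>\<^bsub>A\<^esub> y"
      by (auto simp: r_coset_def)
    moreover have "k \<in> carrier A" "y \<in> carrier A"
      using k N.subset HA P(1) xy by auto
    ultimately have "x \<otimes>\<^bsub>A\<^esub> inv\<^bsub>A\<^esub> y = k"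
      by (simp add: A.m_assoc)
    then show False
      using P(3)[OF xy] k(1) by blast
  qed
  have "inj_on f P"
  proof (rule inj_onI, rule ccontr)
    fix x y assume xy: "x \<in> P" "y \<in> P" "f x = f y" "x \<noteq> y"
    then have "f x \<otimes>\<^bsub>?L\<^esub> inv\<^bsub>?L\<^esub> (f y) = \<one>\<^bsub>?L\<^esub>"
      using f[OF xy(2)] L.r_inv[of "f y"] by simp
    then show False
      using f_K[OF xy(1,2,4)] subgroup.one_closed[OF K_L] by simp
  qed
  then have "card (f ` P) = card P"
    by (rule card_image)
  moreover have "enat (card (f ` P)) \<le> group_index ?L (finite_residual ?L (subtopology T L))"
  proof (rule L.group_index_ge[OF L.subgroup_finite_residual])
    show "f ` P \<subseteq> carrier ?L" "finite (f ` P)"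
      using f P(2) by auto
    show "x \<otimes>\<^bsub>?L\<^esub> inv\<^bsub>?L\<^esub> y \<notin> finite_residual ?L (subtopology T L)"
      if "x \<in> f ` P" "y \<in> f ` P" "x \<noteq> y" for x y
      using that f_K residual by blast
  qed
  ultimately show ?thesis
    by simp
qed

text \<open>For a closed normal M missing x, N is the product of M with the fixator in H of a disc D
  about b, large enough to separate x from M. Transitivity of M makes H the product of M and the
  stabiliser of b. The latter preserves D, which gives normality of N, and it acts on D in finitely
  many ways, which gives finite index.\<close>

lemma open_normal_subgroup_avoiding_point:
  fixes H :: "('c \<Rightarrow> 'c) set"
  assumes H: "subgroup H A" and b: "b \<in> Ch"
    and normal_trans: "\<And>N c d. \<lbrakk>N \<lhd> A\<lparr>carrier := H\<rparr>; N \<noteq> {\<one>\<^bsub>A\<^esub>}; c \<in> Ch; d \<in> Ch\<rbrakk> \<Longrightarrow> \<exists>n\<in>N. n c = d"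
    and x: "x \<in> H" "x \<notin> Mon (A\<lparr>carrier := H\<rparr>) (subtopology T H)"
  shows "\<exists>N R. N \<lhd> A\<lparr>carrier := H\<rparr> \<and> finite (rcosets\<^bsub>A\<lparr>carrier := H\<rparr>\<^esub> N) \<and>
    (\<forall>h\<in>H. (\<forall>z\<in>disc b R. h z = z) \<longrightarrow> h \<in> N) \<and> x \<notin> N"
proof -
  let ?H = "A\<lparr>carrier := H\<rparr>"
  interpret H: group ?H
    using H by (rule A.subgroup_imp_group)
  have HA': "H \<subseteq> carrier A" and HA: "h \<in> H \<Longrightarrow> h \<in> carrier A" for h
    using H subgroup.subset by blast+
  note H_closed = subgroup.m_closed[OF H] subgroup.m_inv_closed[OF H] subgroup.one_closed[OF H]
  have inv_H: "inv\<^bsub>?H\<^esub> h = inv\<^bsub>A\<^esub> h" if "h \<in> H" for h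
    using H that by (rule A.m_inv_consistent)
  obtain M where M: "M \<lhd> ?H" "closedin (subtopology T H) M" "M \<noteq> {\<one>\<^bsub>A\<^esub>}" "x \<notin> M"
    using x unfolding Mon_def by auto
  interpret M: normal M ?H
    by (rule M(1))
  have MH: "n \<in> M \<Longrightarrow> n \<in> H" for n
    using M.subset by auto
  note M_closed = M.m_closed[simplified] M.one_closed[simplified]
  have M_inv: "inv\<^bsub>A\<^esub> n \<in> M" if "n \<in> M" for n
    using M.m_inv_closed[OF that] inv_H MH that by simp
  have M_conj: "h \<otimes>\<^bsub>A\<^esub> n \<otimes>\<^bsub>A\<^esub> inv\<^bsub>A\<^esub> h \<in> M" if "n \<in> M" "h \<in> H" for n h
    using M.inv_op_closed2[of h n] that inv_H by simp
  have "\<exists>F. finite F \<and> F \<subseteq> Ch \<and> \<not> (\<exists>n\<in>M. \<forall>z\<in>F. n z = x z)"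
  proof (rule ccontr)
    assume "\<not> ?thesis"
    then have "x \<in> M"
      by (intro closedin_aut_subtopologyD[OF HA' M(2) x(1)]) simp
    then show False
      using M(4) by simp
  qed
  then obtain F where F: "finite F" "F \<subseteq> Ch" "\<not> (\<exists>n\<in>M. \<forall>z\<in>F. n z = x z)"
    by (elim exE conjE)
  obtain R where R: "F \<subseteq> disc b R"
    using finite_subset_disc[OF b F(1,2)] by blast
  define D where "D = disc b R"
  have D_Ch: "z \<in> Ch" if "z \<in> D" for z
    using that disc_subset[OF b] unfolding D_def by blast
  define N where "N = {h \<in> H. \<exists>n\<in>M. \<forall>z\<in>D. n z = h z}"
  have N_I: "h \<in> N" if "h \<in> H" "n \<in> M" "\<And>z. z \<in> D \<Longrightarrow> n z = h z" for h n
    using that unfolding N_def by blast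
  have NH: "h \<in> N \<Longrightarrow> h \<in> H" for h
    unfolding N_def by blast
  have M_N: "n \<in> N" if "n \<in> M" for n
    using that MH N_I by blast
  have stab: "h \<in> N" if "h \<in> H" "\<And>z. z \<in> D \<Longrightarrow> h z = z" for h
    using that M_closed(2) D_Ch by (intro N_I[of h "\<one>\<^bsub>A\<^esub>"]) (auto simp: aut_one_apply)
  have D_stable: "v z \<in> D" if "v \<in> H" "v b = b" "z \<in> D" for v z
    using aut_disc[OF HA b, of v z R] that unfolding D_def by simp
  have inv_b: "(inv\<^bsub>A\<^esub> v) b = b" if "v \<in> H" "v b = b" for v
    using aut_inv_apply(1)[OF HA b, of v] that by simp
  have N_mult: "h \<otimes>\<^bsub>A\<^esub> k \<in> N" if hk: "h \<in> N" "k \<in> N" for h k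
  proof -
    obtain n m where nm: "n \<in> M" "\<And>z. z \<in> D \<Longrightarrow> n z = h z" "m \<in> M" "\<And>z. z \<in> D \<Longrightarrow> m z = k z"
      using hk unfolding N_def by blast
    note H4 = NH[OF hk(1)] NH[OF hk(2)] MH[OF nm(1)] MH[OF nm(3)]
    \<comment> \<open>\<open>k z\<close> may lie outside D, where n and h can differ, so the product
      of n and m may fail to be a witness. Instead n sends z to \<open>h z\<close>, and the
      conjugate of m by h sends this on to \<open>h (k z)\<close>.\<close>
    show ?thesis
    proof (rule N_I[of _ "(h \<otimes>\<^bsub>A\<^esub> m \<otimes>\<^bsub>A\<^esub> inv\<^bsub>A\<^esub> h) \<otimes>\<^bsub>A\<^esub> n"])
      show "h \<otimes>\<^bsub>A\<^esub> k \<in> H" "(h \<otimes>\<^bsub>A\<^esub> m \<otimes>\<^bsub>A\<^esub> inv\<^bsub>A\<^esub> h) \<otimes>\<^bsub>A\<^esub> n \<in> M"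
        using H4 nm H_closed M_conj M_closed by auto
      show "((h \<otimes>\<^bsub>A\<^esub> m \<otimes>\<^bsub>A\<^esub> inv\<^bsub>A\<^esub> h) \<otimes>\<^bsub>A\<^esub> n) z = (h \<otimes>\<^bsub>A\<^esub> k) z" if "z \<in> D" for z
        using that nm H4[THEN HA] D_Ch by (simp add: aut_mult_apply act_closed aut_inv_apply)
    qed
  qed
  have N_inv: "inv\<^bsub>A\<^esub> h \<in> N" if h: "h \<in> N" for h
  proof -
    obtain n where n: "n \<in> M" "\<And>z. z \<in> D \<Longrightarrow> n z = h z"
      using h unfolding N_def by blast
    note H2 = NH[OF h] MH[OF n(1)]
    \<comment> \<open>The witness is the inverse of n conjugated by the inverse of h: it applies h
      to z, then the inverse of n, which returns to z, and then the inverse of h.\<close>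
    show ?thesis
    proof (rule N_I[of _ "inv\<^bsub>A\<^esub> h \<otimes>\<^bsub>A\<^esub> inv\<^bsub>A\<^esub> n \<otimes>\<^bsub>A\<^esub> inv\<^bsub>A\<^esub> (inv\<^bsub>A\<^esub> h)"])
      show "inv\<^bsub>A\<^esub> h \<in> H" "inv\<^bsub>A\<^esub> h \<otimes>\<^bsub>A\<^esub> inv\<^bsub>A\<^esub> n \<otimes>\<^bsub>A\<^esub> inv\<^bsub>A\<^esub> (inv\<^bsub>A\<^esub> h) \<in> M"
        using H2 n H_closed M_conj M_inv by auto
      fix z assume z: "z \<in> D"
      then have "(inv\<^bsub>A\<^esub> n) (h z) = z"
        using aut_inv_apply(1)[OF HA[OF H2(2)] D_Ch[OF z]] n(2)[OF z] by simp
      then show "(inv\<^bsub>A\<^esub> h \<otimes>\<^bsub>A\<^esub> inv\<^bsub>A\<^esub> n \<otimes>\<^bsub>A\<^esub> inv\<^bsub>A\<^esub> (inv\<^bsub>A\<^esub> h)) z = (inv\<^bsub>A\<^esub> h) z"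
        using H2[THEN HA] D_Ch[OF z] by (simp add: aut_mult_apply act_closed)
    qed
  qed
  have N_conj_b: "v \<otimes>\<^bsub>A\<^esub> h \<otimes>\<^bsub>A\<^esub> inv\<^bsub>A\<^esub> v \<in> N" if h: "h \<in> N" and v: "v \<in> H" "v b = b" for h v
  proof -
    obtain n where n: "n \<in> M" "\<And>z. z \<in> D \<Longrightarrow> n z = h z"
      using h unfolding N_def by blast
    note H3 = NH[OF h] MH[OF n(1)] v(1)
    show ?thesis
    proof (rule N_I[of _ "v \<otimes>\<^bsub>A\<^esub> n \<otimes>\<^bsub>A\<^esub> inv\<^bsub>A\<^esub> v"])
      show "v \<otimes>\<^bsub>A\<^esub> h \<otimes>\<^bsub>A\<^esub> inv\<^bsub>A\<^esub> v \<in> H" "v \<otimes>\<^bsub>A\<^esub> n \<otimes>\<^bsub>A\<^esub> inv\<^bsub>A\<^esub> v \<in> M"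
        using H3 n H_closed M_conj by auto
      fix z assume z: "z \<in> D"
      then have "(inv\<^bsub>A\<^esub> v) z \<in> D"
        by (rule D_stable[OF H_closed(2)[OF v(1)] inv_b[OF v]])
      then show "(v \<otimes>\<^bsub>A\<^esub> n \<otimes>\<^bsub>A\<^esub> inv\<^bsub>A\<^esub> v) z = (v \<otimes>\<^bsub>A\<^esub> h \<otimes>\<^bsub>A\<^esub> inv\<^bsub>A\<^esub> v) z"
        using H3[THEN HA] D_Ch[OF z] n(2) by (simp add: aut_mult_apply act_closed)
    qed
  qed
  have N_sub: "subgroup N ?H"
  proof (rule H.subgroupI)
    show "N \<subseteq> carrier ?H" "N \<noteq> {}"
      using NH M_N[OF M_closed(2)] by auto
  qed (use N_mult N_inv inv_H[OF NH] in simp_all)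
  \<comment> \<open>The factorisation of H into M and the stabiliser of b.\<close>
  have split: "\<exists>n\<in>M. (n \<otimes>\<^bsub>A\<^esub> h) b = b \<and> n \<otimes>\<^bsub>A\<^esub> h \<in> H" if h: "h \<in> H" for h
  proof -
    obtain n where "n \<in> M" "n (h b) = b"
      using normal_trans[OF M(1,3) act_closed[OF HA[OF h] b] b] by blast
    then show ?thesis
      using h MH HA b H_closed by (intro bexI[of _ n]) (simp_all add: aut_mult_apply)
  qed
  have N_norm: "N \<lhd> ?H"
  proof (rule H.normal_invI[OF N_sub])
    fix h g assume "h \<in> carrier ?H" and g: "g \<in> N"
    then have h: "h \<in> H" by simp
    \<comment> \<open>Conjugation by h is conjugation by an element fixing b followed by conjugation
      by an element of M, and M lies in N.\<close>
    obtain n where n: "n \<in> M" "(n \<otimes>\<^bsub>A\<^esub> h) b = b" "n \<otimes>\<^bsub>A\<^esub> h \<in> H"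
      using split[OF h] by blast
    let ?v = "n \<otimes>\<^bsub>A\<^esub> h"
    have *: "inv\<^bsub>A\<^esub> n \<otimes>\<^bsub>A\<^esub> (?v \<otimes>\<^bsub>A\<^esub> g \<otimes>\<^bsub>A\<^esub> inv\<^bsub>A\<^esub> ?v) \<otimes>\<^bsub>A\<^esub> n \<in> N"
      by (intro N_mult M_N M_inv n(1) N_conj_b[OF g n(3,2)])
    have carr: "n \<in> carrier A" "h \<in> carrier A" "g \<in> carrier A"
      using HA MH NH n(1) h g by auto
    have "inv\<^bsub>A\<^esub> n \<otimes>\<^bsub>A\<^esub> (?v \<otimes>\<^bsub>A\<^esub> g \<otimes>\<^bsub>A\<^esub> inv\<^bsub>A\<^esub> ?v) \<otimes>\<^bsub>A\<^esub> n = h \<otimes>\<^bsub>A\<^esub> g \<otimes>\<^bsub>A\<^esub> inv\<^bsub>A\<^esub> h"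
    proof -
      have "inv\<^bsub>A\<^esub> n \<otimes>\<^bsub>A\<^esub> (n \<otimes>\<^bsub>A\<^esub> (h \<otimes>\<^bsub>A\<^esub> (g \<otimes>\<^bsub>A\<^esub> inv\<^bsub>A\<^esub> h))) = h \<otimes>\<^bsub>A\<^esub> (g \<otimes>\<^bsub>A\<^esub> inv\<^bsub>A\<^esub> h)"
        using carr by (simp add: A.m_assoc[symmetric])
      then show ?thesis
        using carr by (simp add: A.inv_mult_group A.m_assoc)
    qed
    then show "h \<otimes>\<^bsub>?H\<^esub> g \<otimes>\<^bsub>?H\<^esub> inv\<^bsub>?H\<^esub> h \<in> N"
      using * inv_H[OF h] by simp
  qed
  have coset_mult: "N #>\<^bsub>?H\<^esub> (n \<otimes>\<^bsub>A\<^esub> h) = N #>\<^bsub>?H\<^esub> h" if "n \<in> N" "h \<in> H" for n h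
    using H.repr_independence[of "n \<otimes>\<^bsub>A\<^esub> h" N h] N_sub that by (auto simp: r_coset_def)
  have "\<exists>n. \<forall>h\<in>H. n h \<in> M \<and> (n h \<otimes>\<^bsub>A\<^esub> h) b = b \<and> n h \<otimes>\<^bsub>A\<^esub> h \<in> H"
    using split by metis
  then obtain n where n: "\<And>h. h \<in> H \<Longrightarrow> n h \<in> M \<and> (n h \<otimes>\<^bsub>A\<^esub> h) b = b \<and> n h \<otimes>\<^bsub>A\<^esub> h \<in> H"
    by blast
  define v where "v h = n h \<otimes>\<^bsub>A\<^esub> h" for h
  have v: "v h \<in> H" "v h b = b" "N #>\<^bsub>?H\<^esub> v h = N #>\<^bsub>?H\<^esub> h" if "h \<in> H" for h
    using n[OF that] coset_mult[OF M_N that] unfolding v_def by auto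
  \<comment> \<open>The coset of h depends only on the action of \<open>v h\<close> on the finite
    disc D, which bounds the number of cosets.\<close>
  have coset_eq: "N #>\<^bsub>?H\<^esub> h = N #>\<^bsub>?H\<^esub> k"
    if hk: "h \<in> H" "k \<in> H" "restrict (v h) D = restrict (v k) D" for h k
  proof -
    have vA: "v h \<in> carrier A" "v k \<in> carrier A"
      using v hk HA by auto
    have "v h \<otimes>\<^bsub>A\<^esub> inv\<^bsub>A\<^esub> (v k) \<in> N"
    proof (rule stab)
      show "v h \<otimes>\<^bsub>A\<^esub> inv\<^bsub>A\<^esub> (v k) \<in> H"
        using v hk H_closed by auto
      fix z assume z: "z \<in> D"
      then have "(inv\<^bsub>A\<^esub> (v k)) z \<in> D"
        by (rule D_stable[OF H_closed(2)[OF v(1)[OF hk(2)]] inv_b[OF v(1,2)[OF hk(2)]]])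
      then have "v h ((inv\<^bsub>A\<^esub> (v k)) z) = v k ((inv\<^bsub>A\<^esub> (v k)) z)"
        using hk(3) by (metis restrict_apply')
      then show "(v h \<otimes>\<^bsub>A\<^esub> inv\<^bsub>A\<^esub> (v k)) z = z"
        using vA D_Ch[OF z] by (simp add: aut_mult_apply aut_inv_apply)
    qed
    then have "N #>\<^bsub>?H\<^esub> (v h \<otimes>\<^bsub>A\<^esub> inv\<^bsub>A\<^esub> (v k) \<otimes>\<^bsub>A\<^esub> v k) = N #>\<^bsub>?H\<^esub> v k"
      using coset_mult v hk by blast
    then have "N #>\<^bsub>?H\<^esub> v h = N #>\<^bsub>?H\<^esub> v k"
      using vA by (simp add: A.m_assoc)
    then show ?thesis
      using v hk by simp
  qed
  have "finite ((\<lambda>h. restrict (v h) D) ` H)"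
  proof (rule finite_subset)
    show "(\<lambda>h. restrict (v h) D) ` H \<subseteq> D \<rightarrow>\<^sub>E D"
      using D_stable v by auto
    show "finite (D \<rightarrow>\<^sub>E D)"
      using finite_disc[OF b] unfolding D_def by (intro finite_PiE) auto
  qed
  moreover have "rcosets\<^bsub>?H\<^esub> N \<subseteq> (\<lambda>f. N #>\<^bsub>?H\<^esub> (SOME h. h \<in> H \<and> restrict (v h) D = f)) ` (\<lambda>h. restrict (v h) D) ` H"
  proof
    fix C assume "C \<in> rcosets\<^bsub>?H\<^esub> N"
    then obtain h where h: "h \<in> H" "C = N #>\<^bsub>?H\<^esub> h"
      by (auto simp: RCOSETS_def)
    let ?k = "SOME k. k \<in> H \<and> restrict (v k) D = restrict (v h) D"
    have "?k \<in> H \<and> restrict (v ?k) D = restrict (v h) D"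
      by (rule someI[of _ h]) (simp add: h)
    then have "C = N #>\<^bsub>?H\<^esub> ?k"
      using coset_eq[of h ?k] h by simp
    then show "C \<in> (\<lambda>f. N #>\<^bsub>?H\<^esub> (SOME h. h \<in> H \<and> restrict (v h) D = f)) ` (\<lambda>h. restrict (v h) D) ` H"
      using h(1) by blast
  qed
  ultimately have "finite (rcosets\<^bsub>?H\<^esub> N)"
    using finite_surj by blast
  moreover have "x \<notin> N"
    using F(3) R unfolding N_def D_def by blast
  ultimately show ?thesis
    using N_norm stab unfolding D_def by blast
qed

end

section \<open>Conjugation as a map, and the index of the whole group\<close>

context group begin

definition conj_by :: "'a \<Rightarrow> 'a \<Rightarrow> 'a" where
  "conj_by x g = x \<otimes> g \<otimes> inv x"

lemma conj_by_closed: "\<lbrakk>x \<in> carrier G; g \<in> carrier G\<rbrakk> \<Longrightarrow> conj_by x g \<in> carrier G"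
  by (simp add: conj_by_def)

lemma conj_by_mult:
  assumes "x \<in> carrier G" "g \<in> carrier G" "h \<in> carrier G"
  shows "conj_by x (g \<otimes> h) = conj_by x g \<otimes> conj_by x h"
proof -
  have "inv x \<otimes> (x \<otimes> (h \<otimes> inv x)) = h \<otimes> inv x"
    using assms by (simp add: m_assoc[symmetric])
  then show ?thesis
    using assms by (simp add: conj_by_def m_assoc)
qed

lemma conj_by_inv: "\<lbrakk>x \<in> carrier G; g \<in> carrier G\<rbrakk> \<Longrightarrow> conj_by x (inv g) = inv (conj_by x g)"
  by (simp add: conj_by_def inv_mult_group m_assoc)

lemma conj_by_conj_by:
  "\<lbrakk>x \<in> carrier G; y \<in> carrier G; g \<in> carrier G\<rbrakk> \<Longrightarrow> conj_by x (conj_by y g) = conj_by (x \<otimes> y) g"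
  by (simp add: conj_by_def inv_mult_group m_assoc)

lemma conj_coset: "(x <# K) #> inv x = conj_by x ` K"
  by (auto simp: l_coset_def r_coset_def conj_by_def)

lemma group_index_carrier: "group_index G (carrier G) = 1"
proof -
  have "carrier G #> x = carrier G" if "x \<in> carrier G" for x
    using that subgroup_self by (simp add: coset_join2)
  then have "rcosets (carrier G) = {carrier G}"
    using one_closed by (auto simp: RCOSETS_def)
  then show ?thesis
    by (simp add: group_index_def one_enat_def)
qed

end

context homogeneous_chamber_graph begin

lemma conj_by_apply:
  "\<lbrakk>x \<in> carrier A; g \<in> carrier A; c \<in> Ch\<rbrakk> \<Longrightarrow> A.conj_by x g c = x (g ((inv\<^bsub>A\<^esub> x) c))"
  by (simp add: A.conj_by_def aut_mult_apply act_closed)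

text \<open>One subgroup is intersected for each point. Finite index survives because a coset of an
  intersection is an intersection of two cosets, and the larger radius serves both fixators.\<close>

lemma open_normal_subgroup_avoiding_finite_set:
  fixes H :: "('c \<Rightarrow> 'c) set"
  assumes H: "subgroup H A" and b: "b \<in> Ch"
    and normal_trans: "\<And>N c d. \<lbrakk>N \<lhd> A\<lparr>carrier := H\<rparr>; N \<noteq> {\<one>\<^bsub>A\<^esub>}; c \<in> Ch; d \<in> Ch\<rbrakk> \<Longrightarrow> \<exists>n\<in>N. n c = d"
    and Q: "finite Q" "Q \<subseteq> H - Mon (A\<lparr>carrier := H\<rparr>) (subtopology T H)"
  shows "\<exists>N R. N \<lhd> A\<lparr>carrier := H\<rparr> \<and> finite (rcosets\<^bsub>A\<lparr>carrier := H\<rparr>\<^esub> N) \<and>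
    (\<forall>h\<in>H. (\<forall>z\<in>disc b R. h z = z) \<longrightarrow> h \<in> N) \<and> N \<inter> Q = {}"
proof -
  let ?H = "A\<lparr>carrier := H\<rparr>"
  interpret H: group ?H
    using H by (rule A.subgroup_imp_group)
  show ?thesis
    using Q
  proof (induction Q rule: finite_induct)
    case empty
    have "carrier ?H \<lhd> ?H"
      by (intro H.normal_invI H.subgroup_self H.m_closed H.inv_closed)
    then have "H \<lhd> ?H"
      by simp
    moreover have "H #>\<^bsub>?H\<^esub> x = H" if "x \<in> H" for x
      using that H.coset_join2[OF _ H.subgroup_self, of x] by simp
    then have "rcosets\<^bsub>?H\<^esub> H \<subseteq> {H}"
      by (auto simp: RCOSETS_def)
    then have "finite (rcosets\<^bsub>?H\<^esub> H)"
      by (rule finite_subset) simp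
    ultimately show ?case
      by (intro exI[of _ H] exI[of _ 0]) simp
  next
    case (insert x Q)
    then obtain N R where N: "N \<lhd> ?H" "finite (rcosets\<^bsub>?H\<^esub> N)"
        "\<forall>h\<in>H. (\<forall>z\<in>disc b R. h z = z) \<longrightarrow> h \<in> N" "N \<inter> Q = {}"
      by auto
    have "x \<in> H" "x \<notin> Mon ?H (subtopology T H)"
      using insert.prems by auto
    from open_normal_subgroup_avoiding_point[OF H b normal_trans this]
    obtain M R' where M: "M \<lhd> ?H" "finite (rcosets\<^bsub>?H\<^esub> M)"
        "\<forall>h\<in>H. (\<forall>z\<in>disc b R'. h z = z) \<longrightarrow> h \<in> M" "x \<notin> M"
      by auto
    have sub: "N \<subseteq> H" "M \<subseteq> H"
      using normal_imp_subgroup[OF N(1)] normal_imp_subgroup[OF M(1)] subgroup.subset by fastforce+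
    have "(N \<inter> M) #>\<^bsub>?H\<^esub> h = (N #>\<^bsub>?H\<^esub> h) \<inter> (M #>\<^bsub>?H\<^esub> h)" if "h \<in> H" for h
    proof -
      have "k = k'" if "k \<in> H" "k' \<in> H" "k \<otimes>\<^bsub>?H\<^esub> h = k' \<otimes>\<^bsub>?H\<^esub> h" for k k'
        using that \<open>h \<in> H\<close> H.r_cancel[of k h k'] by simp
      then show ?thesis
        using sub unfolding r_coset_def by (auto dest: subsetD) (metis IntI subsetD)
    qed
    then have "rcosets\<^bsub>?H\<^esub> (N \<inter> M) \<subseteq> (\<lambda>(C, D). C \<inter> D) ` ((rcosets\<^bsub>?H\<^esub> N) \<times> (rcosets\<^bsub>?H\<^esub> M))"
      by (force simp: RCOSETS_def)
    moreover have "finite ((rcosets\<^bsub>?H\<^esub> N) \<times> (rcosets\<^bsub>?H\<^esub> M))"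
      using N(2) M(2) by simp
    ultimately have "finite (rcosets\<^bsub>?H\<^esub> (N \<inter> M))"
      using finite_surj by blast
    moreover have "h \<in> N \<inter> M" if h: "h \<in> H" "\<forall>z\<in>disc b (max R R'). h z = z" for h
    proof -
      have "\<forall>z\<in>disc b R. h z = z" "\<forall>z\<in>disc b R'. h z = z"
        using h(2) disc_mono[of R "max R R'" b] disc_mono[of R' "max R R'" b]
        by (meson max.cobounded1 max.cobounded2 subsetD)+
      then show ?thesis
        using N(3) M(3) h(1) by simp
    qed
    moreover have "N \<inter> M \<lhd> ?H"
      using H.normal_subgroup_intersect N(1) M(1) by blast
    ultimately show ?case
      using N(4) M(4) by (intro exI[of _ "N \<inter> M"] exI[of _ "max R R'"]) auto
  qed
qed

text \<open>Finitely many conditions suffice: once \<open>Hs n\<close> moves b to every chamber of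
  \<open>disc b 1\<close>, its orbit of b is closed under adjacency, since the neighbours of
  \<open>l b\<close> are translates by l of neighbours of b.\<close>

lemma chabauty_limit_transitive:
  assumes lim: "limitin (chabauty_topology A T) Hs H sequentially" "H \<in> closed_subgroups A T"
    and Hs: "\<And>n. n \<ge> 1 \<Longrightarrow> Hs n \<in> closed_subgroups A T"
    and H_trans: "\<And>c d. \<lbrakk>c \<in> Ch; d \<in> Ch\<rbrakk> \<Longrightarrow> \<exists>h\<in>H. h c = d" and b: "b \<in> Ch"
  shows "\<forall>\<^sub>F n in sequentially. \<forall>d\<in>Ch. \<exists>l\<in>Hs n. l b = d"
proof -
  have "\<forall>\<^sub>F n in sequentially. \<exists>l\<in>Hs n. l b = d" if d: "d \<in> Ch" for d
  proof -
    obtain h where "h \<in> H" "h b = d"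
      using H_trans b d by blast
    then show ?thesis
      using chabauty_limit_upper[OF lim, of h "{b}"] b by simp
  qed
  then have "\<forall>\<^sub>F n in sequentially. \<forall>d\<in>disc b 1. \<exists>l\<in>Hs n. l b = d"
    using disc_subset[OF b, of 1] finite_disc[OF b, of 1] by (intro eventually_ball_finite) blast+
  then show ?thesis
    using eventually_ge_at_top[of 1]
  proof eventually_elim
    case (elim n)
    have L: "subgroup (Hs n) A"
      using Hs[OF elim(2)] by (simp add: closed_subgroups_def)
    have LA: "l \<in> carrier A" if "l \<in> Hs n" for l
      using L that subgroup.subset by blast
    let ?Y = "{d \<in> Ch. \<exists>l\<in>Hs n. l b = d}"
    have "?Y = Ch"
    proof (rule adjacency_connected)
      have "b \<in> ?Y"
        using subgroup.one_closed[OF L] aut_one_apply[of b Ch \<delta>] b by blast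
      then show "?Y \<noteq> {}" by blast
      fix d e assume d: "d \<in> ?Y" and e: "e \<in> Ch" "\<delta> d e \<in> S"
      then obtain l where l: "l \<in> Hs n" "l b = d"
        by blast
      let ?e = "(inv\<^bsub>A\<^esub> l) e"
      have "\<delta> b ?e = \<delta> d e" "?e \<in> Ch"
        using aut_dist[of "inv\<^bsub>A\<^esub> l" Ch \<delta> d e] aut_inv_apply(1)[OF LA[OF l(1)] b] l e LA d
        by (auto simp: act_closed)
      then have "?e \<in> disc b 1"
        using e by auto
      then obtain m where m: "m \<in> Hs n" "m b = ?e"
        using elim(1) by blast
      have "(l \<otimes>\<^bsub>A\<^esub> m) b = e"
        using aut_inv_apply(2)[OF LA[OF l(1)] e(1)] LA l m b by (simp add: aut_mult_apply)
      moreover have "l \<otimes>\<^bsub>A\<^esub> m \<in> Hs n"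
        using L l m by (simp add: subgroup.m_closed)
      ultimately show "e \<in> ?Y"
        using e by blast
    qed blast
    then show ?case by blast
  qed
qed

text \<open>Finitely many orbit representatives lie in a common disc.\<close>

lemma cocompact_disc:
  assumes "subgroup \<Gamma> A" "acts_cocompactly Ch \<Gamma>" "b \<in> Ch"
  shows "\<exists>m. \<forall>c\<in>Ch. \<exists>\<gamma>\<in>\<Gamma>. \<exists>e\<in>disc b m. \<gamma> e = c"
proof -
  let ?orb = "\<lambda>c. {g c | g. g \<in> \<Gamma>}"
  obtain F where F: "F \<subseteq> Ch" "finite F" "?orb ` Ch = ?orb ` F"
    using assms(2) finite_subset_image[of "?orb ` Ch" ?orb Ch] unfolding acts_cocompactly_def by auto
  obtain m where m: "F \<subseteq> disc b m"
    using finite_subset_disc[OF assms(3) F(2,1)] by blast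
  have "\<exists>\<gamma>\<in>\<Gamma>. \<exists>e\<in>disc b m. \<gamma> e = c" if "c \<in> Ch" for c
  proof -
    have "?orb c \<in> ?orb ` F"
      using F(3) that by blast
    then obtain e where "e \<in> F" "?orb c = ?orb e"
      by blast
    moreover have "c \<in> ?orb c"
      using subgroup.one_closed[OF assms(1)] aut_one_apply[OF that, of \<delta>]
      by (intro CollectI exI[of _ "\<one>\<^bsub>A\<^esub>"]) simp
    ultimately show ?thesis
      using m by auto
  qed
  then show ?thesis by blast
qed

end

section \<open>Transferring finite quotients along a Chabauty limit\<close>

context homogeneous_chamber_graph begin

text \<open>Translating source and target by the common cocompact group replaces an arbitrary
  element of \<open>Hs n\<close> by one of bounded displacement at b. There the Chabauty comparison
  on one fixed disc applies, and undoing the translations gives an approximation at the original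
  chamber.\<close>

lemma frequently_group_index_finite_residual_ge:
  fixes H N \<Gamma> P :: "('c \<Rightarrow> 'c) set"
  assumes lim: "limitin (chabauty_topology A T) Hs H sequentially" "H \<in> closed_subgroups A T"
    and Hs: "\<And>n. n \<ge> 1 \<Longrightarrow> Hs n \<in> closed_subgroups A T"
    and H_trans: "\<And>c d. \<lbrakk>c \<in> Ch; d \<in> Ch\<rbrakk> \<Longrightarrow> \<exists>h\<in>H. h c = d" and b: "b \<in> Ch"
    and \<Gamma>: "subgroup \<Gamma> A" "acts_cocompactly Ch \<Gamma>"
    and conj: "\<And>n. n \<ge> 1 \<Longrightarrow> \<exists>\<tau>\<in>carrier A. A.conj_by \<tau> ` \<Gamma> \<subseteq> Hs n"
    and N: "N \<lhd> A\<lparr>carrier := H\<rparr>" "finite (rcosets\<^bsub>A\<lparr>carrier := H\<rparr>\<^esub> N)"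
    and stab: "\<forall>h\<in>H. (\<forall>z\<in>disc b R. h z = z) \<longrightarrow> h \<in> N"
    and P: "P \<subseteq> H" "finite P" "\<And>x y. \<lbrakk>x \<in> P; y \<in> P; x \<noteq> y\<rbrakk> \<Longrightarrow> x \<otimes>\<^bsub>A\<^esub> inv\<^bsub>A\<^esub> y \<notin> N"
  shows "\<exists>\<^sub>F n in sequentially. enat (card P) \<le> group_index (A\<lparr>carrier := Hs n\<rparr>)
    (finite_residual (A\<lparr>carrier := Hs n\<rparr>) (subtopology T (Hs n)))"
proof -
  have H: "subgroup H A" "closedin T H"
    using lim(2) by (simp_all add: closed_subgroups_def)
  have HA: "h \<in> H \<Longrightarrow> h \<in> carrier A" and \<Gamma>A: "g \<in> \<Gamma> \<Longrightarrow> g \<in> carrier A" for h g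
    using H(1) \<Gamma>(1) subgroup.subset by blast+
  note H_closed = subgroup.m_closed[OF H(1)] subgroup.m_inv_closed[OF H(1)]
  define good where "good n \<sigma> \<longleftrightarrow> \<sigma> \<in> carrier A \<and> \<sigma> b = b \<and> A.conj_by \<sigma> ` \<Gamma> \<subseteq> Hs n" for n \<sigma>
  have "\<forall>\<^sub>F n in sequentially. \<forall>d\<in>Ch. \<exists>l\<in>Hs n. l b = d"
    by (rule chabauty_limit_transitive[OF lim Hs H_trans b])
  then have "\<forall>\<^sub>F n in sequentially. \<exists>\<sigma>. good n \<sigma>"
    using eventually_ge_at_top[of 1]
  proof eventually_elim
    case (elim n)
    have L: "subgroup (Hs n) A"
      using Hs[OF elim(2)] by (simp add: closed_subgroups_def)
    obtain \<tau> where \<tau>: "\<tau> \<in> carrier A" "A.conj_by \<tau> ` \<Gamma> \<subseteq> Hs n"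
      using conj[OF elim(2)] by blast
    \<comment> \<open>Left translation of \<tau> by the inverse of l keeps the conjugate of \<Gamma>
      inside \<open>Hs n\<close>, since l belongs to \<open>Hs n\<close>.\<close>
    obtain l where l: "l \<in> Hs n" "l b = \<tau> b"
      using elim(1) act_closed[OF \<tau>(1) b] by blast
    have lA: "l \<in> carrier A"
      using L l subgroup.subset by blast
    have "A.conj_by (inv\<^bsub>A\<^esub> l \<otimes>\<^bsub>A\<^esub> \<tau>) g \<in> Hs n" if g: "g \<in> \<Gamma>" for g
    proof -
      have "A.conj_by (inv\<^bsub>A\<^esub> l) (A.conj_by \<tau> g) \<in> Hs n"
        unfolding A.conj_by_def[of "inv\<^bsub>A\<^esub> l"] using L l \<tau>(2) g
        by (intro subgroup.m_closed[OF L] subgroup.m_inv_closed[OF L]) auto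
      then show ?thesis
        using A.conj_by_conj_by[of "inv\<^bsub>A\<^esub> l" \<tau> g] lA \<tau>(1) \<Gamma>A[OF g] by simp
    qed
    moreover have "(inv\<^bsub>A\<^esub> l \<otimes>\<^bsub>A\<^esub> \<tau>) b = b"
      using aut_inv_apply(1)[OF lA b] l(2) lA \<tau>(1) b by (simp add: aut_mult_apply)
    ultimately have "good n (inv\<^bsub>A\<^esub> l \<otimes>\<^bsub>A\<^esub> \<tau>)"
      using lA \<tau>(1) unfolding good_def by auto
    then show ?case by blast
  qed
  then have "\<forall>\<^sub>F n in sequentially. good n (SOME \<sigma>. good n \<sigma>)"
    by (rule eventually_mono) (erule someI_ex)
  then obtain \<sigma> where \<sigma>: "\<forall>\<^sub>F n in sequentially. good n (\<sigma> n)"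
    by (rule that)
  then have "\<forall>\<^sub>F n in sequentially. \<sigma> n \<in> carrier A \<and> \<sigma> n b = b"
    by (rule eventually_mono) (simp add: good_def)
  from cluster_point_in_stabilizer[OF b this]
  obtain \<tau> where \<tau>: "\<tau> \<in> carrier A" "\<tau> b = b"
    and cluster: "\<And>F. \<lbrakk>finite F; F \<subseteq> Ch\<rbrakk> \<Longrightarrow> \<exists>\<^sub>F n in sequentially. \<forall>z\<in>F. \<sigma> n z = \<tau> z"
    by blast
  have \<tau>_inv: "(inv\<^bsub>A\<^esub> \<tau>) b = b"
    using aut_inv_apply(1)[OF \<tau>(1) b] \<tau>(2) by simp
  have \<Gamma>_H: "A.conj_by \<tau> g \<in> H" if g: "g \<in> \<Gamma>" for g
  proof -
    let ?x = "A.conj_by \<tau> g"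
    have xA: "?x \<in> carrier A"
      using A.conj_by_closed \<tau>(1) \<Gamma>A[OF g] by blast
    have "\<exists>h\<in>H. \<forall>z\<in>F. h z = ?x z" if F: "finite F" "F \<subseteq> Ch" for F
    proof -
      \<comment> \<open>The conjugates of g by \<open>\<sigma> n\<close> and by \<tau> agree at z
        once the conjugators agree at the preimage of z under \<tau> and at the image of this
        preimage under g. Including b pins down the value at b, so a one-point set bounds the
        displacement.\<close>
      let ?F = "(inv\<^bsub>A\<^esub> \<tau>) ` insert b F"
      let ?F' = "?F \<union> g ` ?F"
      have "finite ?F'" "?F' \<subseteq> Ch"
        using F b \<tau>(1) \<Gamma>A[OF g] by (auto simp: act_closed subset_iff)
      then have "\<exists>\<^sub>F n in sequentially. \<forall>z\<in>?F'. \<sigma> n z = \<tau> z"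
        by (rule cluster)
      moreover have "\<forall>\<^sub>F n in sequentially. \<forall>l\<in>Hs n. l b \<in> {?x b} \<longrightarrow> (\<exists>h\<in>H. \<forall>z\<in>F. h z = l z)"
        using act_closed[OF xA b] F by (intro chabauty_limit_lower[OF lim b]) auto
      with \<sigma> have "\<forall>\<^sub>F n in sequentially. good n (\<sigma> n) \<and>
          (\<forall>l\<in>Hs n. l b \<in> {?x b} \<longrightarrow> (\<exists>h\<in>H. \<forall>z\<in>F. h z = l z))"
        by (rule eventually_conj)
      ultimately have "\<exists>\<^sub>F n in sequentially. (good n (\<sigma> n) \<and>
          (\<forall>l\<in>Hs n. l b \<in> {?x b} \<longrightarrow> (\<exists>h\<in>H. \<forall>z\<in>F. h z = l z))) \<and> (\<forall>z\<in>?F'. \<sigma> n z = \<tau> z)"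
        by (rule frequently_eventually_conj)
      then obtain n where n: "\<forall>z\<in>?F'. \<sigma> n z = \<tau> z" "good n (\<sigma> n)"
          "\<And>l. \<lbrakk>l \<in> Hs n; l b = ?x b\<rbrakk> \<Longrightarrow> \<exists>h\<in>H. \<forall>z\<in>F. h z = l z"
        by (auto dest: frequently_ex)
      let ?l = "A.conj_by (\<sigma> n) g"
      have \<sigma>A: "\<sigma> n \<in> carrier A"
        using n(2) good_def by blast
      have eq: "?l z = ?x z" if z: "z \<in> insert b F" for z
      proof -
        have zCh: "z \<in> Ch"
          using z b F by auto
        have "\<sigma> n ((inv\<^bsub>A\<^esub> \<tau>) z) = z"
          using n(1) z aut_inv_apply(2)[OF \<tau>(1) zCh] by auto
        then have "(inv\<^bsub>A\<^esub> (\<sigma> n)) z = (inv\<^bsub>A\<^esub> \<tau>) z"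
          using aut_inv_apply(1)[OF \<sigma>A act_closed[OF A.inv_closed[OF \<tau>(1)] zCh]] by simp
        moreover have "\<sigma> n (g ((inv\<^bsub>A\<^esub> \<tau>) z)) = \<tau> (g ((inv\<^bsub>A\<^esub> \<tau>) z))"
          using n(1) z by auto
        ultimately show ?thesis
          using conj_by_apply[OF \<sigma>A \<Gamma>A[OF g] zCh] conj_by_apply[OF \<tau>(1) \<Gamma>A[OF g] zCh] by simp
      qed
      have "?l \<in> Hs n"
        using n(2) g unfolding good_def by blast
      then show ?thesis
        using n(3)[of ?l] eq by auto
    qed
    then show ?thesis
      using closedin_aut_subtopologyD[OF order_refl, of Ch \<delta> H ?x] H(2) xA
      by (simp add: topspace_aut_topology[symmetric])
  qed
  obtain m where m: "\<And>c. c \<in> Ch \<Longrightarrow> \<exists>g\<in>\<Gamma>. \<exists>e\<in>disc b m. g e = c"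
    using cocompact_disc[OF \<Gamma> b] by blast
  have cover: "\<exists>g\<in>\<Gamma>. \<exists>e\<in>disc b m. A.conj_by \<tau> g e = c" if c: "c \<in> Ch" for c
  proof -
    obtain g e where g: "g \<in> \<Gamma>" "e \<in> disc b m" "g e = (inv\<^bsub>A\<^esub> \<tau>) c"
      using m[OF act_closed[OF A.inv_closed[OF \<tau>(1)] c]] by blast
    have eCh: "e \<in> Ch"
      using g disc_subset[OF b] by blast
    have "A.conj_by \<tau> g (\<tau> e) = c"
      using conj_by_apply[OF \<tau>(1) \<Gamma>A[OF g(1)] act_closed[OF \<tau>(1) eCh]] g(3)
        aut_inv_apply(1)[OF \<tau>(1) eCh] aut_inv_apply(2)[OF \<tau>(1) c] by simp
    moreover have "\<tau> e \<in> disc b m"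
      using aut_disc[OF \<tau>(1) b g(2)] \<tau>(2) by simp
    ultimately show ?thesis
      using g(1) by blast
  qed
  \<comment> \<open>A disc of radius \<open>Suc R\<close> about a chamber of \<open>disc b m\<close>
    lies in \<open>disc b M\<close>. F also contains the images of \<open>disc b R\<close> under P,
    so that conjugation by \<theta>, which will fix F, preserves the values of lifts of P
    there.\<close>
  define M where "M = m + Suc R"
  define F where "F = disc b M \<union> (\<Union>h\<in>P. h ` disc b R)"
  have F: "finite F" "F \<subseteq> Ch"
    using finite_disc[OF b] disc_subset[OF b] P HA act_closed unfolding F_def by (auto simp: subset_iff)
  let ?F = "(inv\<^bsub>A\<^esub> \<tau>) ` F"
  have "finite ?F" "?F \<subseteq> Ch"
    using F \<tau>(1) act_closed by auto
  then have "\<exists>\<^sub>F n in sequentially. \<forall>z\<in>?F. \<sigma> n z = \<tau> z"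
    by (rule cluster)
  \<comment> \<open>The elements to be compared send some chamber of \<open>disc b m\<close> to
    another one, hence move b by at most m + m.\<close>
  moreover have "\<forall>\<^sub>F n in sequentially. \<forall>l\<in>Hs n. l b \<in> disc b (m + m) \<longrightarrow> (\<exists>h\<in>H. \<forall>z\<in>disc b M. h z = l z)"
    using finite_disc[OF b] disc_subset[OF b] by (intro chabauty_limit_lower[OF lim b])
  moreover have "\<forall>\<^sub>F n in sequentially. \<forall>h\<in>P. \<exists>l\<in>Hs n. \<forall>z\<in>disc b R. l z = h z"
    using P(1,2) finite_disc[OF b] disc_subset[OF b]
    by (intro eventually_ball_finite ballI chabauty_limit_upper[OF lim]) auto
  ultimately have "\<exists>\<^sub>F n in sequentially. (good n (\<sigma> n) \<and> n \<ge> 1 \<and>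
      (\<forall>l\<in>Hs n. l b \<in> disc b (m + m) \<longrightarrow> (\<exists>h\<in>H. \<forall>z\<in>disc b M. h z = l z)) \<and>
      (\<forall>h\<in>P. \<exists>l\<in>Hs n. \<forall>z\<in>disc b R. l z = h z)) \<and> (\<forall>z\<in>?F. \<sigma> n z = \<tau> z)"
    using \<sigma> eventually_ge_at_top[of 1]
    by (intro frequently_eventually_conj eventually_conj)
  then show ?thesis
  proof (rule frequently_elim1)
    fix n
    assume "(good n (\<sigma> n) \<and> n \<ge> 1 \<and>
      (\<forall>l\<in>Hs n. l b \<in> disc b (m + m) \<longrightarrow> (\<exists>h\<in>H. \<forall>z\<in>disc b M. h z = l z)) \<and>
      (\<forall>h\<in>P. \<exists>l\<in>Hs n. \<forall>z\<in>disc b R. l z = h z)) \<and> (\<forall>z\<in>?F. \<sigma> n z = \<tau> z)"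
    then have \<sigma>_\<tau>: "\<And>z. z \<in> F \<Longrightarrow> \<sigma> n ((inv\<^bsub>A\<^esub> \<tau>) z) = \<tau> ((inv\<^bsub>A\<^esub> \<tau>) z)"
      and good_n: "good n (\<sigma> n)" and "n \<ge> 1"
      and lower: "\<And>l. \<lbrakk>l \<in> Hs n; l b \<in> disc b (m + m)\<rbrakk> \<Longrightarrow> \<exists>h\<in>H. \<forall>z\<in>disc b M. h z = l z"
      and upper: "\<And>h. h \<in> P \<Longrightarrow> \<exists>l\<in>Hs n. \<forall>z\<in>disc b R. l z = h z"
      by auto
    have L: "subgroup (Hs n) A"
      using Hs[OF \<open>n \<ge> 1\<close>] by (simp add: closed_subgroups_def)
    have LA: "l \<in> carrier A" if "l \<in> Hs n" for l
      using L that subgroup.subset by blast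
    have \<sigma>A: "\<sigma> n \<in> carrier A"
      using good_n good_def by blast
    define \<theta> where "\<theta> = \<tau> \<otimes>\<^bsub>A\<^esub> inv\<^bsub>A\<^esub> (\<sigma> n)"
    have \<theta>A: "\<theta> \<in> carrier A"
      using \<tau>(1) \<sigma>A by (simp add: \<theta>_def)
    have \<theta>\<sigma>: "\<theta> \<otimes>\<^bsub>A\<^esub> \<sigma> n = \<tau>"
      using \<tau>(1) \<sigma>A by (simp add: \<theta>_def A.m_assoc)
    \<comment> \<open>On F the inverses of \<open>\<sigma> n\<close> and \<tau> agree, because the
      cluster condition was imposed on the preimage of F under \<tau>.\<close>
    have \<theta>_F: "\<theta> z = z" "(inv\<^bsub>A\<^esub> \<theta>) z = z" if z: "z \<in> F" for z
    proof -
      have zCh: "z \<in> Ch"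
        using z F by blast
      have "\<sigma> n ((inv\<^bsub>A\<^esub> \<tau>) z) = z"
        using \<sigma>_\<tau>[OF z] aut_inv_apply(2)[OF \<tau>(1) zCh] by simp
      then have "(inv\<^bsub>A\<^esub> (\<sigma> n)) z = (inv\<^bsub>A\<^esub> \<tau>) z"
        using aut_inv_apply(1)[OF \<sigma>A act_closed[OF A.inv_closed[OF \<tau>(1)] zCh]] by simp
      then show "\<theta> z = z"
        using aut_mult_apply[OF \<tau>(1) A.inv_closed[OF \<sigma>A] zCh] aut_inv_apply(2)[OF \<tau>(1) zCh]
        by (simp add: \<theta>_def)
      then show "(inv\<^bsub>A\<^esub> \<theta>) z = z"
        using aut_inv_apply(1)[OF \<theta>A zCh] by simp
    qed
    have disc_F: "z \<in> F" if "z \<in> disc b k" "k \<le> M" for z k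
      using that disc_mono[of k M b] unfolding F_def by blast
    show "enat (card P) \<le> group_index (A\<lparr>carrier := Hs n\<rparr>)
      (finite_residual (A\<lparr>carrier := Hs n\<rparr>) (subtopology T (Hs n)))"
    proof (rule group_index_finite_residual_ge[OF H(1) H_trans N b _ L \<theta>A _ P])
      show "h \<in> N" if "h \<in> H" "\<And>z. z \<in> disc b R \<Longrightarrow> h z = z" for h
        using that stab by blast
    next
      fix h assume h: "h \<in> P"
      then obtain l where l: "l \<in> Hs n" "\<forall>z\<in>disc b R. l z = h z"
        using upper by blast
      have "h z = A.conj_by \<theta> l z" if z: "z \<in> disc b R" for z
      proof -
        have "z \<in> F" "h z \<in> F"
          using disc_F[OF z] z h unfolding M_def F_def by auto
        then show ?thesis
          using \<theta>_F l z F(2) conj_by_apply[OF \<theta>A LA[OF l(1)], of z] by auto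
      qed
      then show "\<exists>l\<in>Hs n. \<forall>z\<in>disc b R. h z = (\<theta> \<otimes>\<^bsub>A\<^esub> l \<otimes>\<^bsub>A\<^esub> inv\<^bsub>A\<^esub> \<theta>) z"
        using l(1) unfolding A.conj_by_def by blast
    next
      fix l c assume l: "l \<in> Hs n" and c: "c \<in> Ch"
      define x where "x = A.conj_by \<theta> l"
      have xA: "x \<in> carrier A"
        using A.conj_by_closed[OF \<theta>A LA[OF l]] by (simp add: x_def)
      text \<open>Both c and x c are moved into a disc around b by elements of \<open>\<tau> \<Gamma> \<tau>\<inverse>\<close>,
        which lies in H as well as in the conjugate of \<open>Hs n\<close> by \<open>\<theta>\<close>.\<close>
      obtain g1 e1 where g1: "g1 \<in> \<Gamma>" "e1 \<in> disc b m" "A.conj_by \<tau> g1 e1 = c"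
        using cover[OF c] by blast
      obtain g2 e2 where g2: "g2 \<in> \<Gamma>" "e2 \<in> disc b m" "A.conj_by \<tau> g2 e2 = x c"
        using cover[OF act_closed[OF xA c]] by blast
      let ?\<gamma>1 = "A.conj_by \<tau> g1" and ?\<gamma>2 = "A.conj_by \<tau> g2"
      let ?l1 = "A.conj_by (\<sigma> n) g1" and ?l2 = "A.conj_by (\<sigma> n) g2"
      have li: "?l1 \<in> Hs n" "?l2 \<in> Hs n"
        using good_n g1(1) g2(1) unfolding good_def by auto
      have \<gamma>_l: "?\<gamma>1 = A.conj_by \<theta> ?l1" "?\<gamma>2 = A.conj_by \<theta> ?l2"
        using A.conj_by_conj_by[OF \<theta>A \<sigma>A] \<Gamma>A g1(1) g2(1) \<theta>\<sigma> by simp_all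
      have \<gamma>H: "?\<gamma>1 \<in> H" "?\<gamma>2 \<in> H"
        using \<Gamma>_H g1(1) g2(1) by auto
      \<comment> \<open>l' is l with source and target translated inside \<open>Hs n\<close>, and y
        is x modified in the same way. Conjugation by \<theta> takes l' to y, and both send
        \<open>e1\<close> to \<open>e2\<close>.\<close>
      define l' where "l' = inv\<^bsub>A\<^esub> ?l2 \<otimes>\<^bsub>A\<^esub> l \<otimes>\<^bsub>A\<^esub> ?l1"
      have l': "l' \<in> Hs n"
        unfolding l'_def using L l li by (intro subgroup.m_closed[OF L] subgroup.m_inv_closed[OF L])
      define y where "y = inv\<^bsub>A\<^esub> ?\<gamma>2 \<otimes>\<^bsub>A\<^esub> x \<otimes>\<^bsub>A\<^esub> ?\<gamma>1"
      have y_l': "y = A.conj_by \<theta> l'"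
        unfolding y_def l'_def x_def \<gamma>_l
        using \<theta>A LA l li by (simp add: A.conj_by_mult A.conj_by_inv)
      have y_apply: "y z = (inv\<^bsub>A\<^esub> ?\<gamma>2) (x (?\<gamma>1 z))" if "z \<in> Ch" for z
        unfolding y_def using that \<gamma>H HA xA by (simp add: aut_mult_apply act_closed)
      have eCh: "e1 \<in> Ch" "e2 \<in> Ch"
        using g1(2) g2(2) disc_subset[OF b] by auto
      have eF: "e1 \<in> F" "e2 \<in> F"
        using g1(2) g2(2) disc_F[of _ m] by (auto simp: M_def)
      have "y e1 = e2"
        using y_apply[OF eCh(1)] g1(3) g2(3) aut_inv_apply(1)[OF HA[OF \<gamma>H(2)] eCh(2)] by simp
      then have "\<theta> (l' e1) = \<theta> e2"
        using conj_by_apply[OF \<theta>A LA[OF l'] eCh(1)] \<theta>_F eF y_l' by simp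
      then have l'_e: "l' e1 = e2"
        using aut_inj[OF \<theta>A act_closed[OF LA[OF l'] eCh(1)] eCh(2)] by simp
      have "l' b \<in> disc e2 m"
        using aut_disc[OF LA[OF l'] eCh(1) disc_sym[OF b g1(2)]] l'_e by simp
      then have "l' b \<in> disc b (m + m)"
        using disc_trans[OF g2(2)] by blast
      then obtain h where h: "h \<in> H" "\<forall>z\<in>disc b M. h z = l' z"
        using lower[OF l'] by blast
      \<comment> \<open>The translations are undone for h in place of y. On the disc about c the
        result is x, because the translated chambers and their images under l' lie in
        \<open>disc b M\<close>, where \<theta> is trivial.\<close>
      let ?k = "?\<gamma>2 \<otimes>\<^bsub>A\<^esub> h \<otimes>\<^bsub>A\<^esub> inv\<^bsub>A\<^esub> ?\<gamma>1"
      have "?k z = x z" if z: "z \<in> disc c (Suc R)" for z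
      proof -
        let ?w = "(inv\<^bsub>A\<^esub> ?\<gamma>1) z"
        have zCh: "z \<in> Ch"
          using z disc_subset[OF c] by blast
        have wCh: "?w \<in> Ch"
          using act_closed zCh \<gamma>H HA by simp
        have "(inv\<^bsub>A\<^esub> ?\<gamma>1) c = e1"
          using aut_inv_apply(1)[OF HA[OF \<gamma>H(1)] eCh(1)] g1(3) by simp
        then have w: "?w \<in> disc e1 (Suc R)"
          using aut_disc[OF A.inv_closed[OF HA[OF \<gamma>H(1)]] c z] by simp
        then have wM: "?w \<in> disc b M"
          using disc_trans[OF g1(2)] unfolding M_def by blast
        have "l' ?w \<in> disc b M"
          using aut_disc[OF LA[OF l'] eCh(1) w] l'_e disc_trans[OF g2(2)] unfolding M_def by blast
        then have "y ?w = l' ?w"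
          using conj_by_apply[OF \<theta>A LA[OF l'] wCh] \<theta>_F disc_F[of _ M] wM y_l' by simp
        then have "h ?w = (inv\<^bsub>A\<^esub> ?\<gamma>2) (x z)"
          using h(2) wM y_apply[OF wCh] aut_inv_apply(2)[OF HA[OF \<gamma>H(1)] zCh] by simp
        moreover have "?k z = ?\<gamma>2 (h ?w)"
          using HA \<gamma>H h(1) zCh wCh by (simp add: aut_mult_apply)
        ultimately show ?thesis
          using aut_inv_apply(2)[OF HA[OF \<gamma>H(2)] act_closed[OF xA zCh]] by simp
      qed
      moreover have "?k \<in> H"
        using \<gamma>H h(1) by (intro H_closed)
      ultimately show "\<exists>h\<in>H. \<forall>z\<in>disc c (Suc R). h z = (\<theta> \<otimes>\<^bsub>A\<^esub> l \<otimes>\<^bsub>A\<^esub> inv\<^bsub>A\<^esub> \<theta>) z"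
        unfolding x_def A.conj_by_def by blast
    qed
  qed
qed

text \<open>If the bound failed, the limsup would be a finite k, and k + 1 elements of H would lie
  in distinct cosets of \<open>Mon\<close>. Their pairwise quotients are kept out of one N, and the
  transfer gives index at least k + 1 for infinitely many n.\<close>

theorem group_index_Mon_le_limsup:
  fixes H \<Gamma> :: "('c \<Rightarrow> 'c) set"
  assumes lim: "limitin (chabauty_topology A T) Hs H sequentially" "H \<in> closed_subgroups A T"
    and Hs: "\<And>n. n \<ge> 1 \<Longrightarrow> Hs n \<in> closed_subgroups A T"
    and H_trans: "\<And>c d. \<lbrakk>c \<in> Ch; d \<in> Ch\<rbrakk> \<Longrightarrow> \<exists>h\<in>H. h c = d"
    and normal_trans: "\<And>N c d. \<lbrakk>N \<lhd> A\<lparr>carrier := H\<rparr>; N \<noteq> {\<one>\<^bsub>A\<^esub>}; c \<in> Ch; d \<in> Ch\<rbrakk> \<Longrightarrow> \<exists>n\<in>N. n c = d"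
    and b: "b \<in> Ch"
    and \<Gamma>: "subgroup \<Gamma> A" "acts_cocompactly Ch \<Gamma>"
    and conj: "\<And>n. n \<ge> 1 \<Longrightarrow> \<exists>\<tau>\<in>carrier A. A.conj_by \<tau> ` \<Gamma> \<subseteq> Hs n"
  shows "group_index (A\<lparr>carrier := H\<rparr>) (Mon (A\<lparr>carrier := H\<rparr>) (subtopology T H))
    \<le> limsup (\<lambda>n. group_index (A\<lparr>carrier := Hs n\<rparr>)
        (finite_residual (A\<lparr>carrier := Hs n\<rparr>) (subtopology T (Hs n))))"
proof (rule ccontr)
  let ?H = "A\<lparr>carrier := H\<rparr>"
  let ?i = "\<lambda>n. group_index (A\<lparr>carrier := Hs n\<rparr>)
    (finite_residual (A\<lparr>carrier := Hs n\<rparr>) (subtopology T (Hs n)))"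
  have H: "subgroup H A"
    using lim(2) by (simp add: closed_subgroups_def)
  interpret H: group ?H
    using H by (rule A.subgroup_imp_group)
  assume "\<not> ?thesis"
  then have less: "limsup ?i < group_index ?H (Mon ?H (subtopology T H))"
    by simp
  then obtain k where k: "limsup ?i = enat k"
    by (cases "limsup ?i") auto
  with less have "enat (Suc k) \<le> group_index ?H (Mon ?H (subtopology T H))"
    by (simp add: Suc_ile_eq)
  then obtain P where P: "P \<subseteq> carrier ?H" "finite P" "card P = Suc k"
      "\<forall>x\<in>P. \<forall>y\<in>P. x \<noteq> y \<longrightarrow> x \<otimes>\<^bsub>?H\<^esub> inv\<^bsub>?H\<^esub> y \<notin> Mon ?H (subtopology T H)"
    by (rule H.group_index_geE[OF H.subgroup_Mon])
  let ?Q = "(\<lambda>(x, y). x \<otimes>\<^bsub>A\<^esub> inv\<^bsub>A\<^esub> y) ` {(x, y) \<in> P \<times> P. x \<noteq> y}"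
  have PH: "P \<subseteq> H"
    using P(1) by simp
  have finite_Q: "finite ?Q"
    by (rule finite_imageI, rule finite_subset[of _ "P \<times> P"]) (use P(2) in auto)
  have Q_H: "?Q \<subseteq> H - Mon ?H (subtopology T H)"
  proof
    fix q assume "q \<in> ?Q"
    then obtain x y where xy: "x \<in> P" "y \<in> P" "x \<noteq> y" "q = x \<otimes>\<^bsub>A\<^esub> inv\<^bsub>A\<^esub> y"
      by auto
    have "x \<in> H" "y \<in> H"
      using PH xy by auto
    moreover have "x \<otimes>\<^bsub>?H\<^esub> inv\<^bsub>?H\<^esub> y \<notin> Mon ?H (subtopology T H)"
      using P(4) xy(1-3) by blast
    ultimately show "q \<in> H - Mon ?H (subtopology T H)"
      unfolding xy(4) by (simp add: A.m_inv_consistent[OF H]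
        subgroup.m_closed[OF H] subgroup.m_inv_closed[OF H])
  qed
  have "\<exists>N R. N \<lhd> ?H \<and> finite (rcosets\<^bsub>?H\<^esub> N) \<and>
      (\<forall>h\<in>H. (\<forall>z\<in>disc b R. h z = z) \<longrightarrow> h \<in> N) \<and> N \<inter> ?Q = {}"
    by (rule open_normal_subgroup_avoiding_finite_set[OF H b _ finite_Q Q_H]) (rule normal_trans)
  then obtain N R where N: "N \<lhd> ?H" "finite (rcosets\<^bsub>?H\<^esub> N)"
      "\<forall>h\<in>H. (\<forall>z\<in>disc b R. h z = z) \<longrightarrow> h \<in> N" "N \<inter> ?Q = {}"
    by (elim exE conjE)
  have "\<exists>\<^sub>F n in sequentially. enat (card P) \<le> ?i n"
  proof (rule frequently_group_index_finite_residual_ge[OF lim Hs H_trans b \<Gamma> conj N(1-3) PH P(2)])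
    show "x \<otimes>\<^bsub>A\<^esub> inv\<^bsub>A\<^esub> y \<notin> N" if "x \<in> P" "y \<in> P" "x \<noteq> y" for x y
      using that N(4) by auto
  qed
  moreover have "\<forall>\<^sub>F n in sequentially. ?i n < enat (Suc k)"
    by (rule Limsup_lessD) (simp add: k)
  ultimately have "\<exists>\<^sub>F n in sequentially. ?i n < enat (Suc k) \<and> enat (card P) \<le> ?i n"
    by (rule frequently_eventually_conj)
  from frequently_ex[OF this] obtain n where "?i n < enat (Suc k)" "enat (card P) \<le> ?i n"
    by (elim exE conjE)
  then show False
    unfolding P(3) by simp
qed

end

text \<open>Chamber-transitivity is Weyl-transitivity for pairs at distance
  \<open>\<one>\<close>.\<close>

lemma (in building) homogeneous_chamber_graph:
  assumes "locally_finite_building S Ch \<delta>" "weyl_transitive W Ch \<delta> H" "H \<subseteq> carrier (aut_group Ch \<delta>)"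
  shows "homogeneous_chamber_graph S Ch \<delta>"
proof
  show "\<delta> d c \<in> S" if "c \<in> Ch" "d \<in> Ch" "\<delta> c d \<in> S" for c d
    using that dist_generator_sym by simp
  show "\<exists>g\<in>carrier (aut_group Ch \<delta>). g c = d" if "c \<in> Ch" "d \<in> Ch" for c d
    using that assms(2,3) WD1[of c c] WD1[of d d] one_closed unfolding weyl_transitive_def by blast
qed (use assms(1) adjacency_connected in blast)+

theorem corollary6p3:
  fixes W :: "('w, 'b) monoid_scheme" and S :: "'w set"
    and Ch :: "'c set" and \<delta> :: "'c \<Rightarrow> 'c \<Rightarrow> 'w"
    and \<Gamma> H :: "('c \<Rightarrow> 'c) set" and Hs :: "nat \<Rightarrow> ('c \<Rightarrow> 'c) set"
  defines "A \<equiv> aut_group Ch \<delta>" and "T \<equiv> aut_topology Ch \<delta>"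
  assumes "building W S Ch \<delta>" and "finite S" and "infinite Ch"
    and "coxeter_irreducible W S"
    and "locally_finite_building S Ch \<delta>" and "thick_building W S Ch \<delta>"
    and "subgroup \<Gamma> A" and "acts_cocompactly Ch \<Gamma>"
    and "\<And>n. n \<ge> 1 \<Longrightarrow> Hs n \<in> closed_subgroups A T"
    and "H \<in> closed_subgroups A T"
    and "limitin (chabauty_topology A T) Hs H sequentially"
    and "weyl_transitive W Ch \<delta> H"
    and "\<And>n. n \<ge> 1 \<Longrightarrow>
      \<exists>\<tau>\<in>carrier A. (\<tau> <#\<^bsub>A\<^esub> \<Gamma>) #>\<^bsub>A\<^esub> inv\<^bsub>A\<^esub> \<tau> \<subseteq> Hs n"
  shows "group_index (A\<lparr>carrier := H\<rparr>) (Mon (A\<lparr>carrier := H\<rparr>) (subtopology T H))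
      \<le> limsup (\<lambda>n. group_index (A\<lparr>carrier := Hs n\<rparr>)
          (finite_residual (A\<lparr>carrier := Hs n\<rparr>) (subtopology T (Hs n))))
    \<and> ((\<forall>n\<ge>1. \<forall>K. subgroup K (A\<lparr>carrier := Hs n\<rparr>) \<and> openin (subtopology T (Hs n)) K
          \<and> group_index (A\<lparr>carrier := Hs n\<rparr>) K < \<infinity> \<longrightarrow> K = Hs n)
        \<longrightarrow> topologically_simple (A\<lparr>carrier := H\<rparr>) (subtopology T H))"
proof -
  interpret building W S Ch \<delta>
    by (rule assms(3))
  have H: "subgroup H A"
    using assms(12) by (simp add: closed_subgroups_def)
  interpret G: homogeneous_chamber_graph S Ch \<delta>
    using assms(7,14) H subgroup.subset unfolding A_def by (intro homogeneous_chamber_graph) blast+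
  let ?H = "A\<lparr>carrier := H\<rparr>"
  interpret H: group ?H
    using H unfolding A_def by (rule G.A.subgroup_imp_group)
  let ?i = "\<lambda>n. group_index (A\<lparr>carrier := Hs n\<rparr>)
    (finite_residual (A\<lparr>carrier := Hs n\<rparr>) (subtopology T (Hs n)))"
  obtain b where b: "b \<in> Ch"
    using Ch_nonempty by blast
  have H_trans: "\<exists>h\<in>H. h c = d" if "c \<in> Ch" "d \<in> Ch" for c d
    using that assms(14) WD1[of c c] WD1[of d d] one_closed unfolding weyl_transitive_def by blast
  have normal_trans: "\<exists>n\<in>N. n c = d"
    if "N \<lhd> ?H" "N \<noteq> {\<one>\<^bsub>A\<^esub>}" "c \<in> Ch" "d \<in> Ch" for N c d
    using weyl_transitive_normal_subgroup_transitive[OF assms(8,6) H[unfolded A_def] assms(14)] that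
    unfolding A_def by blast
  have conj: "\<exists>\<tau>\<in>carrier A. G.A.conj_by \<tau> ` \<Gamma> \<subseteq> Hs n" if "n \<ge> 1" for n
    using assms(15)[OF that] unfolding A_def G.A.conj_coset .
  have bound: "group_index ?H (Mon ?H (subtopology T H)) \<le> limsup ?i"
    using G.group_index_Mon_le_limsup[OF assms(13,12)[unfolded A_def T_def] assms(11)[unfolded A_def T_def]
      H_trans normal_trans[unfolded A_def] b assms(9)[unfolded A_def] assms(10) conj[unfolded A_def]]
    unfolding A_def T_def .
  moreover have "topologically_simple ?H (subtopology T H)"
    if no_finite_index: "\<forall>n\<ge>1. \<forall>K. subgroup K (A\<lparr>carrier := Hs n\<rparr>) \<and> openin (subtopology T (Hs n)) K
      \<and> group_index (A\<lparr>carrier := Hs n\<rparr>) K < \<infinity> \<longrightarrow> K = Hs n"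
  proof -
    \<comment> \<open>Without proper open subgroups of finite index the residual is the whole group.
      The bound from n = 1 on determines the limsup.\<close>
    have "?i n \<le> 1" if n: "n \<ge> 1" for n
    proof -
      have "subgroup (Hs n) A"
        using assms(11)[OF n] by (simp add: closed_subgroups_def)
      then interpret L: group "A\<lparr>carrier := Hs n\<rparr>"
        unfolding A_def by (rule G.A.subgroup_imp_group)
      have "finite_residual (A\<lparr>carrier := Hs n\<rparr>) (subtopology T (Hs n)) = carrier (A\<lparr>carrier := Hs n\<rparr>)"
        using no_finite_index n unfolding finite_residual_def by auto
      then show ?thesis
        using L.group_index_carrier by simp
    qed
    then have "limsup ?i \<le> 1"
      using eventually_sequentiallyI[of 1 "\<lambda>n. ?i n \<le> 1"] by (intro Limsup_bounded) simp
    with bound have index: "group_index ?H (Mon ?H (subtopology T H)) \<le> 1"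
      by (rule order_trans)
    \<comment> \<open>Index at most 1 makes \<open>Mon\<close> all of H: a point outside it and the
      identity would represent two cosets. Every nontrivial closed normal subgroup contains
      \<open>Mon\<close> and hence equals H.\<close>
    have Mon: "x \<in> Mon ?H (subtopology T H)" if x: "x \<in> H" for x
    proof (rule ccontr)
      assume not_Mon: "x \<notin> Mon ?H (subtopology T H)"
      then have "x \<noteq> \<one>\<^bsub>?H\<^esub>"
        using subgroup.one_closed[OF H.subgroup_Mon] by metis
      moreover have "inv\<^bsub>?H\<^esub> x \<notin> Mon ?H (subtopology T H)"
        using not_Mon x subgroup.m_inv_closed[OF H.subgroup_Mon, of "inv\<^bsub>?H\<^esub> x"] by auto
      ultimately have "enat (card {\<one>\<^bsub>?H\<^esub>, x}) \<le> group_index ?H (Mon ?H (subtopology T H))"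
        using x not_Mon H.one_closed H.inv_closed[of x] H.l_one[of "inv\<^bsub>?H\<^esub> x"] H.r_one[of x] H.inv_one
        by (intro H.group_index_ge[OF H.subgroup_Mon]) (auto simp del: H.inv_one)
      then show False
        using index \<open>x \<noteq> \<one>\<^bsub>?H\<^esub>\<close> order_trans by (fastforce simp: one_enat_def)
    qed
    \<comment> \<open>A group that is transitive on more than one chamber is nontrivial.\<close>
    obtain c where "c \<in> Ch" "c \<noteq> b"
      using assms(5) by (metis finite.emptyI finite_insert finite_subset insertI1 subsetI)
    then obtain h where "h \<in> H" "h b = c"
      using H_trans b by blast
    then have "H \<noteq> {\<one>\<^bsub>A\<^esub>}"
      using aut_one_apply[OF b, of \<delta>] \<open>c \<noteq> b\<close> unfolding A_def by auto
    moreover have "N = {\<one>\<^bsub>A\<^esub>} \<or> N = H" if "N \<lhd> ?H" "closedin (subtopology T H) N" for N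
      using Mon that normal_imp_subgroup[OF that(1)] subgroup.subset[of N ?H] unfolding Mon_def by auto
    ultimately show ?thesis
      unfolding topologically_simple_def by auto
  qed
  ultimately show ?thesis
    by blast
qed

end
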